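(* Let $\Bbbk$ be an algebraically closed field of characteristic zero and let $A_{c,q}=\Bbbk[x,y,z]/(c(x)z-q(x,y))$ be a Danielewski-type algebra in reduced form with $\deg(c)\ge2$ and $\deg_y(q)\ge2$. Let $D\in\operatorname{Der}(A_{c,q})$ be a simple derivation. Then the restriction \[ \psi|_{\operatorname{Aut}_D(A_{c,q})}:\operatorname{Aut}_D(A_{c,q})\longrightarrow G_{c,q} \] of the canonical homomorphism $\psi:\operatorname{Aut}(A_{c,q})\to G_{c,q}$ is injective. In particular, $\operatorname{Aut}_D(A_{c,q})$ is isomorphic to a subgroup of $G_{c,q}$.
   Context: Here $c(x)\in\Bbbk[x]$, and $q(x,y)\in\Bbbk[x,y]$ is quasi-monic in $y$, i.e. the coefficient of the highest power of $y$ is in $\Bbbk^*$. A polynomial of degree $m$ is centered if its coefficient in degree $m-1$ is zero. $A_{c,q}$ is in reduced form if $c(x)$ is centered, $q(x,y)$ is centered as a polynomial in $y$ over $\Bbbk[x]$, and $\deg_x(q)<\deg(c)$. Put $n=\deg(c)$, $d=\deg_y(q)$, and \[ G_{c,q}=\{(e,u)\in\Bbbk^*\times\Bbbk^*\mid c(ex)=e^nc(x),\ q(ex,uy)=u^dq(x,y)\}. \] $\bar x,\bar y,\bar z$ denote the images of $x,y,z$ in $A_{c,q}$. It is a known structural fact that every $\Bbbk$-algebra automorphism $\sigma$ of $A_{c,q}$ satisfies $\sigma(\bar x)=e\bar x$, $\sigma(\bar y)=u\bar y+c(\bar x)\ell(\bar x)$ for some $(e,u)\in G_{c,q}$ and $\ell\in\Bbbk[x]$;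 the canonical homomorphism $\psi:\operatorname{Aut}(A_{c,q})\to G_{c,q}$ is $\psi(\sigma)=(e,u)$. It is a surjective (split) group homomorphism with kernel $U_{\Bbbk}(A_{c,q})=\{\exp(\ell(\bar x)\xi_{c,q})\mid\ell\in\Bbbk[x]\}$, where $\xi_{c,q}$ is the locally nilpotent derivation with $\xi_{c,q}(\bar x)=0$, $\xi_{c,q}(\bar y)=c(\bar x)$, $\xi_{c,q}(\bar z)=\partial_yq(\bar x,\bar y)$. $\operatorname{Der}(A)$ is the space of $\Bbbk$-derivations; $D$ is simple if the only ideals $I\subseteq A$ with $D(I)\subseteq I$ are $0$ and $A$; $\operatorname{Aut}_D(A)$ is the group of $\Bbbk$-algebra automorphisms $\sigma$ of $A$ with $\sigma D=D\sigma$. *)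

theory Defs
  imports
    "HOL-Algebra.QuotRing"
    "HOL-Algebra.Bij"
    "HOL-Algebra.Algebraic_Closure_Type"
    "HOL-Computational_Algebra.Computational_Algebra"
begin

text \<open>
  Polynomial rings are nested: \<open>'k poly\<close> is k[x], \<open>'k poly poly\<close> is k[x][y] (so \<^const>\<open>degree\<close> and
  \<^const>\<open>lead_coeff\<close> there refer to y), and \<open>'k poly poly poly\<close> is k[x][y][z].
\<close>

definition quasi_monic :: "'k::field poly poly \<Rightarrow> bool" where
  "quasi_monic q \<longleftrightarrow> (\<exists>a. a \<noteq> 0 \<and> lead_coeff q = [:a:])"

text \<open>Truncated subtraction makes this wrong for degree 0; it is only used for degree at least 2.\<close>

definition centered :: "'a::zero poly \<Rightarrow> bool" where
  "centered p \<longleftrightarrow> coeff p (degree p - 1) = 0"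

definition deg_x :: "'k::zero poly poly \<Rightarrow> nat" where
  "deg_x q = (MAX i\<in>{..degree q}. degree (coeff q i))"

definition reduced_form :: "'k::field poly \<Rightarrow> 'k poly poly \<Rightarrow> bool" where
  "reduced_form c q \<longleftrightarrow> centered c \<and> centered q \<and> deg_x q < degree c"


section \<open>The algebra\<close>

abbreviation Kxyz :: "'k::field poly poly poly ring" where
  "Kxyz \<equiv> ring_of_type_algebra"

text \<open>The polynomial \<open>c(x) z - q(x,y)\<close>, written by its coefficients in z.\<close>

definition dan_rel :: "'k::field poly \<Rightarrow> 'k poly poly \<Rightarrow> 'k poly poly poly" where
  "dan_rel c q = [:- q, [:c:]:]"

definition dan_ideal :: "'k::field poly \<Rightarrow> 'k poly poly \<Rightarrow> 'k poly poly poly set" where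
  "dan_ideal c q = PIdl\<^bsub>Kxyz\<^esub> (dan_rel c q)"

definition dan_alg :: "'k::field poly \<Rightarrow> 'k poly poly \<Rightarrow> 'k poly poly poly set ring" where
  "dan_alg c q = Kxyz Quot (dan_ideal c q)"

definition cls :: "'k::field poly \<Rightarrow> 'k poly poly \<Rightarrow> 'k poly poly poly \<Rightarrow> 'k poly poly poly set" where
  "cls c q f = dan_ideal c q +>\<^bsub>Kxyz\<^esub> f"

definition scal :: "'k::field poly \<Rightarrow> 'k poly poly \<Rightarrow> 'k \<Rightarrow> 'k poly poly poly set" where
  "scal c q a = cls c q [:[:[:a:]:]:]"

text \<open>The element \<open>p(x)\<close> of the algebra, for p in k[x].\<close>

definition cls_x :: "'k::field poly \<Rightarrow> 'k poly poly \<Rightarrow> 'k poly \<Rightarrow> 'k poly poly poly set" where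
  "cls_x c q p = cls c q [:[:p:]:]"

definition xbar :: "'k::field poly \<Rightarrow> 'k poly poly \<Rightarrow> 'k poly poly poly set" where
  "xbar c q = cls_x c q [:0, 1:]"

definition ybar :: "'k::field poly \<Rightarrow> 'k poly poly \<Rightarrow> 'k poly poly poly set" where
  "ybar c q = cls c q [:[:0, 1:]:]"


section \<open>Derivations and automorphisms\<close>

definition dan_Der :: "'k::field poly \<Rightarrow> 'k poly poly
    \<Rightarrow> ('k poly poly poly set \<Rightarrow> 'k poly poly poly set) set" where
  "dan_Der c q = {D. let A = dan_alg c q in
     D \<in> carrier A \<rightarrow> carrier A \<and>
     (\<forall>f\<in>carrier A. \<forall>g\<in>carrier A. D (f \<oplus>\<^bsub>A\<^esub> g) = D f \<oplus>\<^bsub>A\<^esub> D g) \<and>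
     (\<forall>a. \<forall>f\<in>carrier A. D (scal c q a \<otimes>\<^bsub>A\<^esub> f) = scal c q a \<otimes>\<^bsub>A\<^esub> D f) \<and>
     (\<forall>f\<in>carrier A. \<forall>g\<in>carrier A.
        D (f \<otimes>\<^bsub>A\<^esub> g) = (f \<otimes>\<^bsub>A\<^esub> D g) \<oplus>\<^bsub>A\<^esub> (D f \<otimes>\<^bsub>A\<^esub> g))}"

definition simple_derivation :: "('b, 'm) ring_scheme \<Rightarrow> ('b \<Rightarrow> 'b) \<Rightarrow> bool" where
  "simple_derivation A D \<longleftrightarrow>
     (\<forall>I. ideal I A \<longrightarrow> D ` I \<subseteq> I \<longrightarrow> I = {\<zero>\<^bsub>A\<^esub>} \<or> I = carrier A)"

text \<open>
  The underlying set of automorphisms consists of extensional functions (via \<^const>\<open>Bij\<close>), so that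
  equality of automorphisms is equality on the carrier; the group law is composition.
\<close>

definition dan_Aut :: "'k::field poly \<Rightarrow> 'k poly poly
    \<Rightarrow> ('k poly poly poly set \<Rightarrow> 'k poly poly poly set) monoid" where
  "dan_Aut c q = (let A = dan_alg c q in BijGroup (carrier A)
     \<lparr>carrier := {s \<in> Bij (carrier A). s \<in> ring_hom A A \<and> (\<forall>a. s (scal c q a) = scal c q a)}\<rparr>)"

definition dan_AutD :: "'k::field poly \<Rightarrow> 'k poly poly
    \<Rightarrow> ('k poly poly poly set \<Rightarrow> 'k poly poly poly set)
    \<Rightarrow> ('k poly poly poly set \<Rightarrow> 'k poly poly poly set) monoid" where
  "dan_AutD c q D = (dan_Aut c q)
     \<lparr>carrier := {s \<in> carrier (dan_Aut c q). \<forall>f\<in>carrier (dan_alg c q). s (D f) = D (s f)}\<rparr>"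


section \<open>The group and the canonical homomorphism\<close>

text \<open>\<open>subst_xy e u q\<close> is \<open>q(ex, uy)\<close>.\<close>

definition subst_xy :: "'k::field \<Rightarrow> 'k \<Rightarrow> 'k poly poly \<Rightarrow> 'k poly poly" where
  "subst_xy e u q = (map_poly (\<lambda>p. p \<circ>\<^sub>p [:0, e:]) q) \<circ>\<^sub>p [:0, [:u:]:]"

definition dan_G :: "'k::field poly \<Rightarrow> 'k poly poly \<Rightarrow> ('k \<times> 'k) monoid" where
  "dan_G c q =
     \<lparr>carrier = {(e, u). e \<noteq> 0 \<and> u \<noteq> 0 \<and>
         c \<circ>\<^sub>p [:0, e:] = smult (e ^ degree c) c \<and>
         subst_xy e u q = smult [:u ^ degree q:] q},
      monoid.mult = (\<lambda>(e, u) (e', u'). (e * e', u * u')),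
      one = (1, 1)\<rparr>"

text \<open>
  Under the hypotheses of the main statement the pair \<open>(e, u)\<close> exists for every automorphism; it is
  unique because x and y are algebraically independent in the algebra.
\<close>

definition dan_psi :: "'k::field poly \<Rightarrow> 'k poly poly
    \<Rightarrow> ('k poly poly poly set \<Rightarrow> 'k poly poly poly set) \<Rightarrow> 'k \<times> 'k" where
  "dan_psi c q s = (THE (e, u). (e, u) \<in> carrier (dan_G c q) \<and>
     (let A = dan_alg c q in
       s (xbar c q) = scal c q e \<otimes>\<^bsub>A\<^esub> xbar c q \<and>
       (\<exists>l. s (ybar c q) =
          (scal c q u \<otimes>\<^bsub>A\<^esub> ybar c q) \<oplus>\<^bsub>A\<^esub> (cls_x c q c \<otimes>\<^bsub>A\<^esub> cls_x c q l))))"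

end

theory Submission
  imports Defs
begin

text \<open>
  Inverting c and expanding at \<open>x = \<infinity>\<close>, the algebra becomes a subring \<open>B\<close> of the polynomials in y over
  the field of Laurent series in \<open>1/x\<close>, generated by x, y and \<open>z = q/c\<close>. Division by q
  gives normal forms. They show that the kernel of this realization is exactly the defining ideal,
  and they determine which leading monomials (degree in y, then degree in x) occur
  (\<open>realize_y_reduced\<close>, \<open>realize_eq_0_iff\<close>).

  The value of \<open>\<psi>\<close> at an automorphism \<open>\<sigma>\<close> only makes sense once it is known that
  \<open>\<sigma> x = e x\<close> and \<open>\<sigma> y = u y + c l\<close> with \<open>(e,u)\<close> in the group. The core of this is that every
  nonzero locally nilpotent derivation of the algebra has its kernel inside k[x]
  (\<open>kernel_of_lnd\<close>). If W is in the kernel of \<open>\<delta>\<close>, then \<open>\<delta>\<close> is a multiple of the Jacobian with W, so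
  it shifts leading monomials by a constant vector unless they are parallel to that of W.
  If W had positive degree in y, local nilpotency at x, y and z together with the shape of the
  semigroup of leading monomials would contradict \<open>degree c \<ge> 2\<close> and \<open>degree q \<ge> 2\<close>. Applied to
  the conjugate of \<open>c d/dy\<close> by \<open>\<sigma>\<close> this yields \<open>\<sigma> x \<in> k[x]\<close>. Affineness in x and y then follows by
  degree counts, and the reduced form removes the translation in x, makes the translation
  in y divisible by c and puts \<open>(e,u)\<close> into the group (\<open>aut_structure\<close>).

  Uniqueness of \<open>(e,u)\<close> makes \<open>\<psi>\<close> multiplicative. An element of its kernel is a shift
  \<open>x \<mapsto> x\<close>, \<open>y \<mapsto> y + c l\<close>. If \<open>l\<close> were nonzero and the shift commuted with a simple derivation D,
  then \<open>D x\<close> would be a nonzero constant and \<open>c l\<close> would divide its own derivative, which is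
  impossible in characteristic zero (\<open>commuting_shift_trivial\<close>).
  The remaining part carries these facts back to the quotient ring.
\<close>

unbundle fps_syntax

section \<open>Extension of ring homomorphisms to polynomials\<close>

text \<open>
Homomorphisms of commutative rings live here on whole types. The universal property of
polynomial rings is used three times over: for the embedding of k[x] into a field, for its
extension to k[x][y], and for the evaluation of z at \<open>q/c\<close>.
\<close>

definition unital_hom :: "('a::comm_ring_1 \<Rightarrow> 'b::comm_ring_1) \<Rightarrow> bool" where
  "unital_hom h \<longleftrightarrow> h 1 = 1 \<and> (\<forall>a b. h (a + b) = h a + h b) \<and> (\<forall>a b. h (a * b) = h a * h b)"

lemma unital_hom_rules:
  assumes "unital_hom h"
  shows "h 1 = 1" "h (a + b) = h a + h b" "h (a * b) = h a * h b"
    "h 0 = 0" "h (- a) = - h a" "h (a - b) = h a - h b"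
proof -
  show add: "h (a + b) = h a + h b" for a b
    using assms by (simp add: unital_hom_def)
  show "h 1 = 1" "h (a * b) = h a * h b"
    using assms by (simp_all add: unital_hom_def)
  show zero: "h 0 = 0" using add[of 0 0] by simp
  show neg: "h (- a) = - h a" for a
    using add[of a "- a"] zero by (simp add: eq_neg_iff_add_eq_0 add.commute)
  show "h (a - b) = h a - h b" using add[of a "- b"] neg[of b] by simp
qed

definition poly_ext :: "('a::comm_ring_1 \<Rightarrow> 'b::comm_ring_1) \<Rightarrow> 'b \<Rightarrow> 'a poly \<Rightarrow> 'b" where
  "poly_ext h v p = poly (map_poly h p) v"

lemma poly_ext_pCons:
  assumes "unital_hom h"
  shows "poly_ext h v (pCons a p) = h a + v * poly_ext h v p"
  by (simp add: poly_ext_def map_poly_pCons unital_hom_rules[OF assms])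

lemma poly_ext_0 [simp]: "poly_ext h v 0 = 0"
  by (simp add: poly_ext_def)

lemma unital_hom_poly_ext:
  assumes h: "unital_hom h"
  shows "unital_hom (poly_ext h v)"
proof -
  note P = poly_ext_pCons[OF h] and H = unital_hom_rules[OF h]
  have add: "poly_ext h v (p + q) = poly_ext h v p + poly_ext h v q" for p q
    by (induction p q rule: poly_induct2) (simp_all add: P H algebra_simps)
  have smult: "poly_ext h v (smult a p) = h a * poly_ext h v p" for a p
    by (induction p) (simp_all add: P H algebra_simps)
  have "poly_ext h v (p * q) = poly_ext h v p * poly_ext h v q" for p q
    by (induction p) (simp_all add: P H add smult algebra_simps)
  moreover have "poly_ext h v 1 = 1"
    using P[of v 1 0] by (simp add: H flip: one_pCons)
  ultimately show ?thesis using add by (simp add: unital_hom_def)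
qed

section \<open>Expansion at infinity\<close>

text \<open>
The Laurent series variable stands for \<open>1/x\<close>, so the degree of a polynomial in x becomes minus
the subdegree of its expansion. This makes the degree in x available as a discrete valuation of
a field that contains k(x) and that carries a derivation extending \<open>d/dx\<close>.
\<close>

definition at_inf :: "'k::field_char_0 poly \<Rightarrow> 'k fls" where
  "at_inf = poly_ext fls_const fls_X_inv"

lemma unital_hom_fls_const: "unital_hom (fls_const :: 'k::field_char_0 \<Rightarrow> 'k fls)"
  by (simp add: unital_hom_def fls_plus_const)

lemma unital_hom_at_inf: "unital_hom at_inf"
  unfolding at_inf_def by (intro unital_hom_poly_ext unital_hom_fls_const)

lemmas at_inf_hom [simp] = unital_hom_rules[OF unital_hom_at_inf]

lemma at_inf_pCons: "at_inf (pCons a p) = fls_const a + fls_X_inv * at_inf p"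
  unfolding at_inf_def by (rule poly_ext_pCons[OF unital_hom_fls_const])

lemma at_inf_degree:
  assumes "p \<noteq> 0"
  shows "at_inf p \<noteq> 0 \<and> fls_subdegree (at_inf p) = - int (degree p)"
  using assms
proof (induction p)
  case (pCons a p)
  show ?case
  proof (cases "p = 0")
    case True
    then show ?thesis using pCons by (simp add: at_inf_pCons)
  next
    case False
    have sub: "fls_subdegree (fls_X_inv * at_inf p) = - 1 - int (degree p)"
      using pCons False by (simp)
    have lt: "fls_subdegree (fls_X_inv * at_inf p) < fls_subdegree (fls_const a)"
      using sub by simp
    have nz: "fls_X_inv * at_inf p \<noteq> 0" using pCons False by simp
    have "fls_subdegree (fls_const a + fls_X_inv * at_inf p) = - 1 - int (degree p)"
      using fls_subdegree_add_eq1[OF nz lt] sub by (simp add: add.commute)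
    moreover have "fls_const a + fls_X_inv * at_inf p \<noteq> 0"
    proof
      assume "fls_const a + fls_X_inv * at_inf p = 0"
      then have "fls_subdegree (fls_const a + fls_X_inv * at_inf p) = 0" by simp
      then show False using calculation by simp
    qed
    ultimately show ?thesis using False by (simp add: at_inf_pCons)
  qed
qed simp

lemma at_inf_eq_0_iff [simp]: "at_inf p = 0 \<longleftrightarrow> p = 0"
  using at_inf_degree by fastforce

lemma at_inf_eq_iff [simp]: "at_inf p = at_inf q \<longleftrightarrow> p = q"
  using at_inf_eq_0_iff[of "p - q"] by (simp del: at_inf_eq_0_iff)

lemma at_inf_subdegree [simp]: "fls_subdegree (at_inf p) = - int (degree p)"
  by (cases "p = 0") (simp_all add: at_inf_degree)

definition kxy :: "'k::field_char_0 poly poly \<Rightarrow> 'k fls poly" where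
  "kxy = poly_ext (\<lambda>p. [:at_inf p:]) [:0, 1:]"

lemma unital_hom_pCons_at_inf: "unital_hom (\<lambda>p. [:at_inf p:])"
  by (simp add: unital_hom_def pCons_one)

lemma unital_hom_kxy: "unital_hom kxy"
  unfolding kxy_def by (intro unital_hom_poly_ext unital_hom_pCons_at_inf)

lemmas kxy_hom [simp] = unital_hom_rules[OF unital_hom_kxy]

lemma kxy_pCons [simp]: "kxy (pCons p P) = pCons (at_inf p) (kxy P)"
  unfolding kxy_def by (simp add: poly_ext_pCons[OF unital_hom_pCons_at_inf])

lemma coeff_kxy [simp]: "coeff (kxy P) i = at_inf (coeff P i)"
  by (induction P arbitrary: i) (auto simp: coeff_pCons split: nat.split)

lemma degree_kxy [simp]: "degree (kxy P) = degree P"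
  by (rule antisym) (auto intro!: degree_le simp: coeff_eq_0,
      metis coeff_kxy at_inf_eq_0_iff coeff_eq_0)

lemma kxy_eq_0_iff [simp]: "kxy P = 0 \<longleftrightarrow> P = 0"
  by (auto simp: poly_eq_iff)

lemma kxy_eq_iff [simp]: "kxy P = kxy Q \<longleftrightarrow> P = Q"
  by (auto simp: poly_eq_iff)

lemma kxy_smult [simp]: "kxy (smult p P) = smult (at_inf p) (kxy P)"
  by (auto simp: poly_eq_iff)

section \<open>The algebra as a ring of polynomials in y over Laurent series\<close>

locale danielewski =
  fixes c :: "'k::field_char_0 poly" and q :: "'k poly poly"
  assumes quasi_monic_q: "quasi_monic q"
    and degree_c: "degree c \<ge> 2"
    and degree_q: "degree q \<ge> 2"
begin

text \<open>
Since c is invertible in the field, the relation forces \<open>z = q/c\<close>. The algebra is the subring \<open>B\<close> generated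
by the scalars, x, y and \<open>q/c\<close>, and \<open>realize\<close> is evaluation at these generators.
\<close>

definition zfun :: "'k fls poly" where
  "zfun = smult (inverse (at_inf c)) (kxy q)"

definition realize :: "'k poly poly poly \<Rightarrow> 'k fls poly" where
  "realize = poly_ext kxy zfun"

definition B :: "'k fls poly set" where
  "B = range realize"

lemma unital_hom_realize: "unital_hom realize"
  unfolding realize_def by (intro unital_hom_poly_ext unital_hom_kxy)

lemmas realize_hom [simp] = unital_hom_rules[OF unital_hom_realize]

lemma realize_pCons [simp]: "realize (pCons p P) = kxy p + zfun * realize P"
  unfolding realize_def by (rule poly_ext_pCons[OF unital_hom_kxy])

lemma c_nonzero [simp]: "c \<noteq> 0" and q_nonzero [simp]: "q \<noteq> 0"
  using degree_c degree_q by auto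

lemma c_zfun: "smult (at_inf c) zfun = kxy q"
  by (simp add: zfun_def)

lemma zfun_nonzero [simp]: "zfun \<noteq> 0"
  by (simp add: zfun_def)

lemma realize_dan_rel: "realize (dan_rel c q) = 0"
  by (simp add: dan_rel_def c_zfun)

lemma lead_coeff_q: obtains a where "a \<noteq> 0" "lead_coeff q = [:a:]"
  using quasi_monic_q by (auto simp: quasi_monic_def)

text \<open>
Reduced representatives are those whose coefficients (with respect to z) have y-degree below
that of q. They are a normal form modulo the relation because q is quasi-monic: division by q
replaces a high power of y by lower powers and by multiples of \<open>c z\<close>.
\<close>

definition y_reduced :: "'k poly poly poly \<Rightarrow> bool" where
  "y_reduced P \<longleftrightarrow> (\<forall>k. degree (coeff P k) < degree q)"

lemma y_reduced_add: "y_reduced P \<Longrightarrow> y_reduced Q \<Longrightarrow> y_reduced (P + Q)"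
  by (simp add: y_reduced_def degree_add_less)

lemma y_reduced_smult: "y_reduced P \<Longrightarrow> y_reduced (smult [:p:] P)"
  by (auto simp: y_reduced_def intro: le_less_trans[OF degree_smult_le])

lemma y_reduced_pCons: "y_reduced (pCons p P) \<longleftrightarrow> degree p < degree q \<and> y_reduced P"
proof
  assume A: "y_reduced (pCons p P)"
  then have "degree (coeff (pCons p P) 0) < degree q"
    "\<And>k. degree (coeff (pCons p P) (Suc k)) < degree q"
    unfolding y_reduced_def by blast+
  then show "degree p < degree q \<and> y_reduced P" by (simp add: y_reduced_def)
qed (auto simp: y_reduced_def coeff_pCons split: nat.split)

lemma y_reduced_0 [simp]: "y_reduced 0"
  using degree_q by (simp add: y_reduced_def)

text \<open>
Write \<open>p = p' + s q\<close> with \<open>p'\<close> of smaller degree; modulo the relation, \<open>s q\<close> is \<open>c z s\<close>,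
and s has smaller degree than p as well, so that both parts are covered by induction.
\<close>

lemma normal_form_const: "\<exists>P. y_reduced P \<and> dan_rel c q dvd [:p:] - P"
proof (induction "degree p" arbitrary: p rule: less_induct)
  case less
  show ?case
  proof (cases "degree p < degree q")
    case True
    then show ?thesis by (intro exI[of _ "[:p:]"]) (simp add: y_reduced_pCons)
  next
    case False
    obtain a where a: "a \<noteq> 0" "lead_coeff q = [:a:]" by (rule lead_coeff_q)
    define s where "s = monom (smult (inverse a) (lead_coeff p)) (degree p - degree q)"
    have s: "degree s < degree p"
      unfolding s_def using False degree_q by (intro le_less_trans[OF degree_monom_le]) auto
    have "degree (s * q) \<le> degree p"
      unfolding s_def using False
      by (intro order.trans[OF degree_mult_le])
        (metis add_right_mono degree_monom_le le_add_diff_inverse2 linorder_not_less)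
    moreover have "coeff (s * q) (degree p) = lead_coeff p"
      using False a unfolding s_def by (subst coeff_monom_mult) (simp)
    ultimately have "p - s * q = 0 \<or> degree (p - s * q) < degree p"
      by (intro eq_zero_or_degree_less) (auto intro: degree_diff_le)
    then have p': "degree (p - s * q) < degree p"
      using False degree_q by auto
    obtain P' where P': "y_reduced P'" "dan_rel c q dvd [:p - s * q:] - P'"
      using less[OF p'] by blast
    obtain S where S: "y_reduced S" "dan_rel c q dvd [:s:] - S"
      using less[OF s] by blast
    have "[:p:] - (P' + pCons 0 (smult [:c:] S))
        = ([:p - s * q:] - P') + [:0, [:c:]:] * ([:s:] - S) + dan_rel c q * [:- s:]"
      by (simp add: dan_rel_def algebra_simps smult_diff_right)
    also have "dan_rel c q dvd \<dots>"
      using P' S by (intro dvd_add[OF dvd_add[OF _ dvd_mult] dvd_triv_left])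
    finally show ?thesis
      using P' S degree_q
      by (intro exI[of _ "P' + pCons 0 (smult [:c:] S)"])
        (auto intro!: y_reduced_add y_reduced_smult simp: y_reduced_pCons)
  qed
qed

lemma normal_form: "\<exists>Q. y_reduced Q \<and> dan_rel c q dvd P - Q"
proof (induction P)
  case (pCons p P)
  then obtain Q where Q: "y_reduced Q" "dan_rel c q dvd P - Q" by blast
  obtain Q' where Q': "y_reduced Q'" "dan_rel c q dvd [:p:] - Q'"
    using normal_form_const by blast
  have "pCons p P - (Q' + pCons 0 Q) = ([:p:] - Q') + [:0, 1:] * (P - Q)"
    by simp
  also have "dan_rel c q dvd \<dots>" using Q Q' by (intro dvd_add dvd_mult) auto
  finally show ?case using Q Q' degree_q
    by (intro exI[of _ "Q' + pCons 0 Q"]) (auto intro!: y_reduced_add simp: y_reduced_pCons)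
qed (auto intro: exI[of _ 0])

lemma degree_zfun [simp]: "degree zfun = degree q"
  by (simp add: zfun_def)

lemma lead_coeff_zfun: "fls_subdegree (lead_coeff zfun) = int (degree c)"
proof -
  obtain a where "a \<noteq> 0" "lead_coeff q = [:a:]" by (rule lead_coeff_q)
  then show ?thesis by (simp add: zfun_def fls_inverse_subdegree)
qed

text \<open>
For a reduced representative the summands belonging to different powers of z have different
y-degrees, since z has y-degree \<open>degree q\<close> and the coefficients stay below that. No cancellation
of leading terms can occur, and the leading term is that of the highest power of z. This gives
injectivity on normal forms and all the degree information about elements of \<open>B\<close> at once.
\<close>

lemma realize_y_reduced:
  assumes "y_reduced P" "P \<noteq> 0"
  shows "realize P \<noteq> 0 \<and> (\<exists>i j. j < degree q \<and> degree (realize P) = j + degree q * degree P \<and>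
     fls_subdegree (lead_coeff (realize P)) = int (degree c) * int (degree P) - int i)"
  using assms
proof (induction P)
  case (pCons p P)
  show ?case
  proof (cases "P = 0")
    case True
    then show ?thesis using pCons
      by (auto simp: y_reduced_pCons)
  next
    case False
    have p: "degree p < degree q" and P: "y_reduced P"
      using pCons.prems by (auto simp: y_reduced_pCons)
    obtain i j where ij: "j < degree q" "degree (realize P) = j + degree q * degree P"
      "fls_subdegree (lead_coeff (realize P)) = int (degree c) * int (degree P) - int i"
      and nz: "realize P \<noteq> 0" using pCons.IH[OF P False] by blast
    have deg: "degree (zfun * realize P) = degree q + degree (realize P)"
      using nz by (simp add: degree_mult_eq)
    have lt: "degree (kxy p) < degree (zfun * realize P)" using p deg by simp
    have lc: "lead_coeff (realize (pCons p P)) = lead_coeff zfun * lead_coeff (realize P)"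
      using lead_coeff_add_le[OF lt] by (simp add: lead_coeff_mult)
    have "degree (realize (pCons p P)) = j + degree q * degree (pCons p P)"
      using degree_add_eq_right[OF lt] deg ij False by (simp add: algebra_simps)
    moreover have "fls_subdegree (lead_coeff (realize (pCons p P)))
        = int (degree c) * int (degree (pCons p P)) - int i"
    proof -
      have "lead_coeff zfun \<noteq> 0" "lead_coeff (realize P) \<noteq> 0"
        using nz by (simp_all only: leading_coeff_0_iff zfun_nonzero not_False_eq_True)
      then show ?thesis
        unfolding lc using ij(3) False lead_coeff_zfun by (simp add: algebra_simps)
    qed
    moreover have "realize (pCons p P) \<noteq> 0"
      using lt degree_add_eq_right[OF lt] by auto
    ultimately show ?thesis using ij(1) by blast
  qed
qed simp

lemma realize_eq_0_iff: "realize P = 0 \<longleftrightarrow> dan_rel c q dvd P"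
proof
  assume 0: "realize P = 0"
  obtain Q where Q: "y_reduced Q" "dan_rel c q dvd P - Q" using normal_form by blast
  then have "realize Q = realize P"
    by (metis diff_0_right diff_eq_diff_eq dvdE mult_zero_left realize_dan_rel realize_hom(3,6))
  then have "Q = 0" using realize_y_reduced Q 0 by auto
  with Q show "dan_rel c q dvd P" by simp
next
  assume "dan_rel c q dvd P"
  then show "realize P = 0" by (auto simp: dvd_def realize_dan_rel)
qed

lemma B_normal_form:
  assumes "f \<in> B"
  obtains P where "y_reduced P" "f = realize P"
proof -
  obtain P where P: "f = realize P" using assms by (auto simp: B_def)
  obtain Q where Q: "y_reduced Q" "dan_rel c q dvd P - Q" using normal_form by blast
  then have "realize (P - Q) = 0" by (simp only: realize_eq_0_iff)
  with Q P that[of Q] show ?thesis by simp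
qed

text \<open>
The bidegrees (degree in y, degree in x of the leading coefficient) of elements of \<open>B\<close> lie in the
semigroup generated by those of x, y and z, which are \<open>(0,1)\<close>, \<open>(1,0)\<close> and \<open>(d,-n)\<close>, where
n is the degree of c and d the degree of q in y.
\<close>

lemma B_bidegree:
  assumes "f \<in> B" "f \<noteq> 0"
  obtains i j k where "degree f = j + degree q * k"
    "fls_subdegree (lead_coeff f) = int (degree c) * int k - int i"
proof -
  obtain P where "y_reduced P" "f = realize P" using B_normal_form[OF assms(1)] .
  with assms realize_y_reduced[of P] that show ?thesis by force
qed

lemma B_degree_less:
  assumes "f \<in> B" "degree f < degree q"
  shows "\<exists>P. f = kxy P"
proof -
  obtain P where P: "y_reduced P" "f = realize P" using B_normal_form[OF assms(1)] .
  have "degree P = 0"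
  proof (rule ccontr)
    assume "degree P \<noteq> 0"
    moreover from this have "P \<noteq> 0" by auto
    ultimately obtain j where "degree f = j + degree q * degree P"
      using realize_y_reduced[of P] P by blast
    moreover have "degree q * 1 \<le> degree q * degree P"
      using \<open>degree P \<noteq> 0\<close> by (intro mult_left_mono) auto
    ultimately show False using assms(2) by simp
  qed
  then obtain p where "P = [:p:]" by (rule degree_eq_zeroE)
  with P show ?thesis by auto
qed

lemma B_degree_zfun:
  assumes "f \<in> B" "degree f = degree q"
  shows "\<exists>r s. f = kxy r + smult (at_inf s) zfun \<and> degree r < degree q"
proof -
  obtain P where P: "y_reduced P" "f = realize P" using B_normal_form[OF assms(1)] .
  have nz: "P \<noteq> 0" using P assms degree_q by auto
  obtain j where j: "degree f = j + degree q * degree P" "j < degree q"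
    using realize_y_reduced[OF P(1) nz] P by blast
  have "degree P \<noteq> 0" using j assms by (cases "degree P = 0") auto
  have "degree P < 2"
  proof (rule ccontr)
    assume "\<not> degree P < 2"
    then have "degree q * 2 \<le> degree q * degree P" by (intro mult_left_mono) auto
    then show False using j(1) assms(2) degree_q by linarith
  qed
  with \<open>degree P \<noteq> 0\<close> have dP: "degree P = 1" by simp
  obtain r P1 where P1: "P = pCons r P1" by (cases P)
  have "degree P1 = 0" using dP P1 by (auto split: if_splits)
  then obtain s where s: "P = [:r, s:]" using P1 by (metis degree_eq_zeroE)
  have sr: "y_reduced [:r, s:]" using P s by simp
  have ds: "degree s = 0"
  proof -
    have "s \<noteq> 0" using dP s by auto
    have "degree (zfun * kxy s) = degree q + degree s"
      using \<open>s \<noteq> 0\<close> by (simp add: degree_mult_eq)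
    moreover have "degree (kxy r + zfun * kxy s) = degree (zfun * kxy s)"
      using sr calculation by (intro degree_add_eq_right) (simp add: y_reduced_pCons)
    ultimately show ?thesis using P s assms by simp
  qed
  then obtain s' where "s = [:s':]" by (rule degree_eq_zeroE)
  with P s sr show ?thesis by (auto simp: y_reduced_pCons)
qed

lemma B_closed:
  shows "f \<in> B \<Longrightarrow> g \<in> B \<Longrightarrow> f + g \<in> B"
    and "f \<in> B \<Longrightarrow> g \<in> B \<Longrightarrow> f * g \<in> B"
    and kxy_in_B: "kxy P \<in> B"
    and zfun_in_B: "zfun \<in> B"
proof -
  show "f \<in> B \<Longrightarrow> g \<in> B \<Longrightarrow> f + g \<in> B" "f \<in> B \<Longrightarrow> g \<in> B \<Longrightarrow> f * g \<in> B"
    unfolding B_def by (auto simp flip: realize_hom)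
  show "kxy P \<in> B" unfolding B_def by (rule range_eqI[of _ _ "[:P:]"]) simp
  show "zfun \<in> B" unfolding B_def by (rule range_eqI[of _ _ "[:0, 1:]"]) simp
qed

lemma at_inf_in_B: "[:at_inf p:] \<in> B"
  using kxy_in_B[of "[:p:]"] by simp

abbreviation scalar :: "'k \<Rightarrow> 'k fls poly" where "scalar a \<equiv> [:fls_const a:]"
abbreviation xfun :: "'k fls poly" where "xfun \<equiv> [:fls_X_inv:]"
abbreviation yfun :: "'k fls poly" where "yfun \<equiv> [:0, 1:]"

lemma at_inf_const: "at_inf [:a:] = fls_const a"
  and at_inf_X: "at_inf [:0, 1:] = fls_X_inv"
  by (simp_all add: at_inf_pCons)

lemma xfun_in_B: "xfun \<in> B" using at_inf_in_B[of "[:0,1:]"] by (simp only: at_inf_X)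
lemma yfun_in_B: "yfun \<in> B" using kxy_in_B[of "[:0,1:]"] by simp
lemma scalar_in_B: "scalar a \<in> B" using at_inf_in_B[of "[:a:]"] by (simp only: at_inf_const)

text \<open>
Induction along sums and products of the generators, so that a property that is only preserved
inside \<open>B\<close> can be propagated from the generators; \<open>B_induct\<close> adds z.
\<close>

lemma xy_induct [case_names scalar x y add mult]:
  assumes sc: "\<And>a. S (scalar a)" and x: "S xfun" and y: "S yfun"
    and add: "\<And>P Q. S (kxy P) \<Longrightarrow> S (kxy Q) \<Longrightarrow> S (kxy P + kxy Q)"
    and mult: "\<And>P Q. S (kxy P) \<Longrightarrow> S (kxy Q) \<Longrightarrow> S (kxy P * kxy Q)"
  shows "S (kxy P)"
proof -
  have p: "S (kxy [:p:])" for p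
  proof (induction p)
    case 0 then show ?case using sc[of 0] by simp
  next
    case (pCons a p)
    have "S (kxy [:[:0,1:]:] * kxy [:p:])"
      using pCons x by (intro mult) (simp_all add: at_inf_X)
    then have "S (kxy [:[:a:]:] + kxy ([:[:0,1:]:] * [:p:]))"
      using sc[of a] by (intro add) (simp_all only: kxy_hom, simp_all add: at_inf_const)
    then show ?case by (simp only: kxy_hom(2,3)[symmetric]) simp
  qed
  show ?thesis
  proof (induction P)
    case 0 then show ?case using p[of 0] by simp
  next
    case (pCons p P)
    have "S (kxy [:0,1:] * kxy P)"
      using pCons y by (intro mult) simp_all
    then have "S (kxy [:p:] + kxy ([:0,1:] * P))"
      using p[of p] by (intro add) (simp_all only: kxy_hom)
    then show ?case by (simp only: kxy_hom(2,3)[symmetric]) simp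
  qed
qed

lemma B_induct [consumes 1, case_names scalar x y z add mult]:
  assumes f: "f \<in> B"
    and sc: "\<And>a. S (scalar a)" and x: "S xfun" and y: "S yfun" and z: "S zfun"
    and add: "\<And>f g. f \<in> B \<Longrightarrow> g \<in> B \<Longrightarrow> S f \<Longrightarrow> S g \<Longrightarrow> S (f + g)"
    and mult: "\<And>f g. f \<in> B \<Longrightarrow> g \<in> B \<Longrightarrow> S f \<Longrightarrow> S g \<Longrightarrow> S (f * g)"
  shows "S f"
proof -
  have xy: "S (kxy P)" for P
    by (rule xy_induct) (use sc x y add mult kxy_in_B in auto)
  have "S (realize P)" for P
  proof (induction P)
    case 0 then show ?case using xy[of 0] by simp
  next
    case (pCons p P)
    then show ?case
      using xy[of p] z by (auto intro!: add mult B_closed kxy_in_B zfun_in_B simp: B_def)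
  qed
  then show ?thesis using f by (auto simp: B_def)
qed

end

section \<open>Leading monomials\<close>

text \<open>
Bidegrees are compared lexicographically: first the degree in y, then the degree in x of the
coefficient, which is minus the subdegree. \<open>below F m i\<close> bounds the bidegree of F by \<open>(m, -i)\<close>, and
\<open>leads F m i\<close> says that the bound is attained. Stating bounds and the coefficient at the bound
separately avoids case distinctions about cancellation.
\<close>

definition below :: "'k::field_char_0 fls poly \<Rightarrow> nat \<Rightarrow> int \<Rightarrow> bool" where
  "below F m i \<longleftrightarrow> degree F \<le> m \<and> (\<forall>n<i. coeff F m $$ n = 0)"

definition leads :: "'k::field_char_0 fls poly \<Rightarrow> nat \<Rightarrow> int \<Rightarrow> bool" where
  "leads F m i \<longleftrightarrow> below F m i \<and> coeff F m $$ i \<noteq> 0"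

lemma leads_iff: "leads F m i \<longleftrightarrow> F \<noteq> 0 \<and> degree F = m \<and> fls_subdegree (lead_coeff F) = i"
proof
  assume L: "leads F m i"
  then have nz: "coeff F m \<noteq> 0" by (auto simp: leads_def)
  then have "degree F = m"
    using L by (auto simp: leads_def below_def intro: antisym le_degree)
  moreover from this have "fls_subdegree (lead_coeff F) = i"
    using L by (auto simp: leads_def below_def intro!: fls_subdegree_eqI)
  ultimately show "F \<noteq> 0 \<and> degree F = m \<and> fls_subdegree (lead_coeff F) = i" using nz by auto
next
  assume "F \<noteq> 0 \<and> degree F = m \<and> fls_subdegree (lead_coeff F) = i"
  then show "leads F m i"
    by (auto simp: leads_def below_def intro: nth_fls_subdegree_nonzero)
qed

lemma coeff_mult_top:
  assumes "degree F \<le> m" "degree G \<le> m'"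
  shows "coeff (F * G) (m + m') = coeff F m * coeff G m'"
proof (cases "degree F = m \<and> degree G = m'")
  case True
  then show ?thesis using coeff_mult_degree_sum[of F G] by simp
next
  case False
  then have "degree (F * G) < m + m'"
    using assms degree_mult_le[of F G] by linarith
  moreover have "coeff F m = 0 \<or> coeff G m' = 0"
    using False assms by (metis coeff_eq_0 le_neq_implies_less)
  ultimately show ?thesis by (auto simp: coeff_eq_0)
qed

lemma fls_mult_top:
  fixes f g :: "'k::field fls"
  assumes "\<forall>n<i. f $$ n = 0" "\<forall>n<j. g $$ n = 0"
  shows "\<forall>n<i+j. (f * g) $$ n = 0" "(f * g) $$ (i + j) = f $$ i * g $$ j"
proof -
  have "(\<forall>n<i+j. (f * g) $$ n = 0) \<and> (f * g) $$ (i + j) = f $$ i * g $$ j"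
  proof (cases "f = 0 \<or> g = 0")
    case False
    then have ij: "i \<le> fls_subdegree f" "j \<le> fls_subdegree g"
      using assms by (auto intro: fls_subdegree_geI)
    show ?thesis
    proof (cases "i = fls_subdegree f \<and> j = fls_subdegree g")
      case True
      moreover have "fls_subdegree (f * g) = fls_subdegree f + fls_subdegree g"
        using False by simp
      ultimately show ?thesis using fls_times_base[of f g] by auto
    next
      case F: False
      then have "i + j < fls_subdegree f + fls_subdegree g" using ij by auto
      moreover have "f $$ i = 0 \<or> g $$ j = 0" using F ij by auto
      ultimately show ?thesis
        using False by auto
    qed
  qed auto
  then show "\<forall>n<i+j. (f * g) $$ n = 0" "(f * g) $$ (i + j) = f $$ i * g $$ j" by auto
qed

lemma below_mult:
  assumes "below F m i" "below G m' i'"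
  shows "below (F * G) (m + m') (i + i')"
    and "coeff (F * G) (m + m') $$ (i + i') = coeff F m $$ i * coeff G m' $$ i'"
proof -
  have d: "degree F \<le> m" "degree G \<le> m'"
    and z: "\<forall>n<i. coeff F m $$ n = 0" "\<forall>n<i'. coeff G m' $$ n = 0"
    using assms by (auto simp: below_def)
  have "degree (F * G) \<le> m + m'"
    using d degree_mult_le[of F G] by linarith
  then show "below (F * G) (m + m') (i + i')"
    using fls_mult_top(1)[OF z] unfolding below_def coeff_mult_top[OF d] by blast
  show "coeff (F * G) (m + m') $$ (i + i') = coeff F m $$ i * coeff G m' $$ i'"
    unfolding coeff_mult_top[OF d] by (rule fls_mult_top(2)[OF z])
qed

lemma below_diff: "below F m i \<Longrightarrow> below G m i \<Longrightarrow> below (F - G) m i"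
  by (simp add: below_def degree_diff_le)

lemma leads_mult: "leads F m i \<Longrightarrow> leads G m' i' \<Longrightarrow> leads (F * G) (m + m') (i + i')"
  by (simp add: leads_def below_mult)

section \<open>Euler operators and the Jacobian of leading monomials\<close>

text \<open>
The operator \<open>x d/dx\<close>. In the variable \<open>1/x\<close> of the series this is minus the usual Euler
operator. Euler operators act diagonally on monomials, so unlike the partial derivatives they
respect bounds on the bidegree without any shift.
\<close>

definition fls_euler :: "'k::field_char_0 fls \<Rightarrow> 'k fls" where
  "fls_euler f = - (fls_X * fls_deriv f)"

lemma fls_euler_nth [simp]: "fls_euler f $$ n = - of_int n * f $$ n"
  by (simp add: fls_euler_def fls_X_times_conv_shift)

lemma fls_euler_0 [simp]: "fls_euler 0 = 0"
  by (simp add: fls_euler_def)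

lemma fls_euler_add: "fls_euler (f + g) = fls_euler f + fls_euler g"
  by (simp add: fls_euler_def algebra_simps)

lemma fls_euler_mult: "fls_euler (f * g) = fls_euler f * g + f * fls_euler g"
  by (simp add: fls_euler_def algebra_simps)

lemma fls_euler_sum: "fls_euler (\<Sum>i\<in>A. h i) = (\<Sum>i\<in>A. fls_euler (h i))"
  by (induction A rule: infinite_finite_induct) (simp_all add: fls_euler_add)

definition euler_x :: "'k::field_char_0 fls poly \<Rightarrow> 'k fls poly" where
  "euler_x = map_poly fls_euler"

definition euler_y :: "'k::field_char_0 fls poly \<Rightarrow> 'k fls poly" where
  "euler_y F = [:0, 1:] * pderiv F"

lemma coeff_euler_x [simp]: "coeff (euler_x F) m = fls_euler (coeff F m)"
  by (simp add: euler_x_def coeff_map_poly)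

lemma coeff_euler_y [simp]: "coeff (euler_y F) m = of_nat m * coeff F m"
  by (cases m) (simp_all add: euler_y_def coeff_pderiv)

lemma euler_x_add: "euler_x (F + G) = euler_x F + euler_x G"
  by (simp add: poly_eq_iff fls_euler_add)

lemma euler_x_mult: "euler_x (F * G) = euler_x F * G + F * euler_x G"
  by (simp add: poly_eq_iff coeff_mult fls_euler_sum fls_euler_mult sum.distrib)

lemma euler_y_add: "euler_y (F + G) = euler_y F + euler_y G"
  by (simp add: euler_y_def pderiv_add algebra_simps)

lemma euler_y_mult: "euler_y (F * G) = euler_y F * G + F * euler_y G"
  by (simp add: euler_y_def pderiv_mult algebra_simps)

lemma below_euler_x: "below F m i \<Longrightarrow> below (euler_x F) m i"
proof -
  have "degree (euler_x F) \<le> degree F"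
    by (intro degree_le) (auto simp: coeff_eq_0)
  then show "below F m i \<Longrightarrow> below (euler_x F) m i"
    by (auto simp: below_def)
qed

lemma below_euler_y: "below F m i \<Longrightarrow> below (euler_y F) m i"
proof -
  have "degree (euler_y F) \<le> degree F"
    by (intro degree_le) (auto simp: coeff_eq_0)
  moreover have "(of_nat m * f) $$ n = of_nat m * f $$ n" for f :: "'a fls" and n
    by (simp add: fls_of_nat)
  ultimately show "below F m i \<Longrightarrow> below (euler_y F) m i"
    by (auto simp: below_def)
qed

lemma leads_euler_y: "leads F m i \<Longrightarrow> m > 0 \<Longrightarrow> leads (euler_y F) m i"
  by (auto simp: leads_def below_euler_y fls_of_nat)

text \<open>
The Jacobian of two monomials with exponent vectors v and w is the determinant of \<open>(v, w)\<close>
times their product. Therefore the leading monomials of two elements determine the leading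
monomial of their Jacobian as soon as the exponent vectors are linearly independent.
\<close>

lemma leads_jacobian:
  fixes W F :: "'k::field_char_0 fls poly"
  assumes W: "leads W a p" and F: "leads F m i" and w: "p * int m - int a * i \<noteq> 0"
  shows "leads (euler_x F * euler_y W - euler_x W * euler_y F) (a + m) (p + i)"
proof -
  note b = W[unfolded leads_def, THEN conjunct1] F[unfolded leads_def, THEN conjunct1]
  have 1: "below (euler_x F * euler_y W) (m + a) (i + p)"
    "coeff (euler_x F * euler_y W) (m + a) $$ (i + p)
      = (- of_int i * coeff F m $$ i) * (of_nat a * coeff W a $$ p)"
    using below_mult[OF below_euler_x[OF b(2)] below_euler_y[OF b(1)]] by (simp_all add: fls_of_nat)
  have 2: "below (euler_x W * euler_y F) (a + m) (p + i)"
    "coeff (euler_x W * euler_y F) (a + m) $$ (p + i)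
      = (- of_int p * coeff W a $$ p) * (of_nat m * coeff F m $$ i)"
    using below_mult[OF below_euler_x[OF b(1)] below_euler_y[OF b(2)]] by (simp_all add: fls_of_nat)
  have "coeff (euler_x F * euler_y W - euler_x W * euler_y F) (a + m) $$ (p + i)
      = of_int (p * int m - int a * i) * (coeff W a $$ p * coeff F m $$ i)"
    using 1(2) 2(2) by (simp add: algebra_simps)
  also have "\<dots> \<noteq> 0"
    using w W F unfolding leads_def of_int_eq_0_iff mult_eq_0_iff by blast
  finally show ?thesis
    unfolding leads_def using 1(1) 2(1) by (simp add: below_diff add.commute)
qed

section \<open>Locally nilpotent derivations\<close>

context danielewski
begin

lemma B_leads:
  assumes "f \<in> B" "leads f m i"
  obtains j l k where "m = j + degree q * k" "i = int (degree c) * int k - int l"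
  using B_bidegree[of f] assms unfolding leads_iff by metis

definition derivation :: "('k fls poly \<Rightarrow> 'k fls poly) \<Rightarrow> bool" where
  "derivation \<delta> \<longleftrightarrow> (\<forall>f\<in>B. \<delta> f \<in> B) \<and> (\<forall>f\<in>B. \<forall>g\<in>B. \<delta> (f + g) = \<delta> f + \<delta> g)
     \<and> (\<forall>f\<in>B. \<forall>g\<in>B. \<delta> (f * g) = f * \<delta> g + \<delta> f * g) \<and> (\<forall>a. \<delta> (scalar a) = 0)"

lemma derivation_rules:
  assumes "derivation \<delta>"
  shows "f \<in> B \<Longrightarrow> \<delta> f \<in> B" "f \<in> B \<Longrightarrow> g \<in> B \<Longrightarrow> \<delta> (f + g) = \<delta> f + \<delta> g"
    "f \<in> B \<Longrightarrow> g \<in> B \<Longrightarrow> \<delta> (f * g) = f * \<delta> g + \<delta> f * g" "\<delta> (scalar a) = 0"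
  using assms by (auto simp: derivation_def)

text \<open>
The chain rule \<open>\<delta> f = f\<^sub>x \<delta> x + f\<^sub>y \<delta> y\<close>, multiplied by y so that both partial derivatives can be
written with Euler operators. It holds on x and y and is inherited by z from the relation
\<open>c z = q\<close>, as c is not a zero divisor.
\<close>

lemma derivation_partials:
  assumes \<delta>: "derivation \<delta>" and f: "f \<in> B"
  shows "yfun * \<delta> f = yfun * euler_x f * [:fls_X:] * \<delta> xfun + euler_y f * \<delta> yfun"
proof -
  note D = derivation_rules[OF \<delta>]
  define L where "L = (\<lambda>f. yfun * \<delta> f - (yfun * euler_x f * [:fls_X:] * \<delta> xfun + euler_y f * \<delta> yfun))"
  have add: "L (f + g) = L f + L g" if "f \<in> B" "g \<in> B" for f g
    by (simp only: L_def D that euler_x_add euler_y_add) (simp only: algebra_simps)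
  have mult: "L (f * g) = f * L g + L f * g" if "f \<in> B" "g \<in> B" for f g
    by (simp only: L_def D that euler_x_mult euler_y_mult) (simp only: algebra_simps)
  have sc: "L (scalar a) = 0" for a
  proof -
    have "euler_x (scalar a) = 0"
      by (simp add: poly_eq_iff coeff_pCons split: nat.split)
        (simp add: fls_euler_def)
    then show ?thesis by (simp add: L_def D euler_y_def pderiv_pCons)
  qed
  have x: "L xfun = 0"
  proof -
    have inv: "fls_X_inv * fls_X = (1 :: 'k fls)" "fls_X * fls_X_inv = (1 :: 'k fls)"
      unfolding fls_inverse_X[symmetric] by simp_all
    have "euler_x xfun = xfun"
      by (simp add: poly_eq_iff coeff_pCons split: nat.split)
        (simp add: fls_euler_def power2_eq_square mult.assoc[symmetric] inv)
    with inv show ?thesis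
      by (simp add: L_def euler_y_def pderiv_pCons)
  qed
  have y: "L yfun = 0"
  proof -
    have "euler_x yfun = 0"
      by (simp add: poly_eq_iff coeff_pCons split: nat.split) (simp add: fls_euler_def)
    then show ?thesis by (simp add: L_def euler_y_def pderiv_pCons)
  qed
  have xy: "L (kxy P) = 0" for P
  proof (rule xy_induct[where S = "\<lambda>f. L f = 0"])
    show "L (kxy P + kxy Q) = 0" if "L (kxy P) = 0" "L (kxy Q) = 0" for P Q
      using that by (simp add: add[OF kxy_in_B kxy_in_B])
    show "L (kxy P * kxy Q) = 0" if "L (kxy P) = 0" "L (kxy Q) = 0" for P Q
      using that by (simp add: mult[OF kxy_in_B kxy_in_B])
  qed (fact sc x y)+
  have z: "L zfun = 0"
  proof -
    have "L ([:at_inf c:] * zfun) = 0" using xy[of q] by (simp add: c_zfun)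
    moreover have "L [:at_inf c:] = 0" using xy[of "[:c:]"] by simp
    ultimately have "[:at_inf c:] * L zfun = 0"
      using mult[OF at_inf_in_B zfun_in_B, of c] by simp
    then show ?thesis by simp
  qed
  have "L f = 0" using f
    by (induction rule: B_induct) (simp_all only: add mult sc x y z, simp_all)
  then show ?thesis by (simp add: L_def)
qed

text \<open>
If \<open>\<delta>\<close> kills W, the chain rule for W eliminates \<open>\<delta> y\<close>: up to the fixed factor \<open>\<delta> x / W\<^sub>y\<close> the
derivation is the Jacobian with W.
\<close>

lemma derivation_jacobian:
  assumes \<delta>: "derivation \<delta>" and W: "W \<in> B" "\<delta> W = 0" and f: "f \<in> B"
  shows "euler_y W * \<delta> f = (euler_x f * euler_y W - euler_x W * euler_y f) * ([:fls_X:] * \<delta> xfun)"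
proof -
  have 1: "euler_y W * \<delta> yfun = - (yfun * euler_x W * [:fls_X:] * \<delta> xfun)"
    unfolding eq_neg_iff_add_eq_0
    using derivation_partials[OF \<delta> W(1)] unfolding W(2) mult_zero_right
    by (simp only: add.commute)
  have "yfun * (euler_y W * \<delta> f) = euler_y W * (yfun * euler_x f * [:fls_X:] * \<delta> xfun)
      + euler_y f * (euler_y W * \<delta> yfun)"
    using derivation_partials[OF \<delta> f] by (simp only: algebra_simps)
  also have "\<dots> = yfun * ((euler_x f * euler_y W - euler_x W * euler_y f) * ([:fls_X:] * \<delta> xfun))"
  proof -
    have "u * (y * v * t * s) + w * - (y * z * t * s) = y * ((v * u - z * w) * (t * s))"
      for u v w y z t s :: "'k fls poly" by (simp add: algebra_simps)
    then show ?thesis unfolding 1 .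
  qed
  finally show ?thesis by (subst (asm) mult_left_cancel) auto
qed

text \<open>
Consequently \<open>\<delta>\<close> shifts bidegrees by a constant vector, as long as the bidegree of the argument
is not parallel to that of W.
\<close>

lemma leads_derivation:
  assumes \<delta>: "derivation \<delta>" and W: "W \<in> B" "\<delta> W = 0" "leads W a p" "a > 0"
    and dx: "leads (\<delta> xfun) e g" and f: "f \<in> B" "leads f m i" and w: "p * int m - int a * i \<noteq> 0"
  shows "leads (\<delta> f) (m + e) (i + g + 1)"
proof -
  have "leads [:fls_X :: 'k fls:] 0 1" by (simp add: leads_iff)
  then have R: "leads (euler_y W * \<delta> f) (a + m + (0 + e)) (p + i + (1 + g))"
    unfolding derivation_jacobian[OF \<delta> W(1,2) f(1)]
    using W(3) dx f(2) w by (intro leads_mult leads_jacobian)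
  then have "\<delta> f \<noteq> 0" by (auto simp: leads_iff)
  then obtain m' i' where L: "leads (\<delta> f) m' i'" by (auto simp: leads_iff)
  have "leads (euler_y W * \<delta> f) (a + m') (p + i')"
    using L W by (intro leads_mult leads_euler_y)
  with R have "a + m' = a + m + (0 + e)" "p + i' = p + i + (1 + g)"
    by (auto simp: leads_iff)
  then have "m' = m + e" "i' = i + g + 1" by simp_all
  with L show ?thesis by simp
qed

text \<open>
Iterating \<open>\<delta>\<close> moves the bidegree of f along an arithmetic progression, and the iteration can only
reach 0 after passing a vector parallel to the bidegree of W. So the determinant of the two
bidegrees is a natural multiple of its decrement per step.
\<close>

lemma nilpotent_wedge:
  assumes \<delta>: "derivation \<delta>" and W: "W \<in> B" "\<delta> W = 0" "leads W a p" "a > 0"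
    and dx: "leads (\<delta> xfun) e g" and f: "f \<in> B" "leads f m i" and nil: "(\<delta> ^^ r) f = 0"
  shows "\<exists>j::nat. p * int m - int a * i = int j * (int a * (g + 1) - p * int e)"
  using f nil
proof (induction r arbitrary: f m i)
  case 0
  then show ?case by (simp add: leads_iff)
next
  case (Suc r)
  show ?case
  proof (cases "p * int m - int a * i = 0")
    case True
    then show ?thesis by (intro exI[of _ 0]) simp
  next
    case False
    have "leads (\<delta> f) (m + e) (i + g + 1)"
      using leads_derivation[OF \<delta> W dx Suc.prems(1,2) False] .
    moreover have "\<delta> f \<in> B" using derivation_rules(1)[OF \<delta>] Suc.prems by blast
    moreover have "(\<delta> ^^ r) (\<delta> f) = 0" using Suc.prems(3) by (simp add: funpow_swap1)
    ultimately obtain j :: nat where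
      "p * int (m + e) - int a * (i + g + 1) = int j * (int a * (g + 1) - p * int e)"
      using Suc.IH by blast
    then show ?thesis
      by (intro exI[of _ "Suc j"]) (simp add: algebra_simps)
  qed
qed

text \<open>
The Makar-Limanov invariant: every nonzero locally nilpotent derivation has its kernel inside
k[x]. Let n be the degree of c and d the degree of q in y. Suppose W in the kernel has positive degree in y. Dividing the determinants against the
bidegree of W by the decrement N gives a linear weight that takes natural values \<open>P\<close>, \<open>r\<close> on
x, y, a nonnegative value on z, and that drops by one under \<open>\<delta>\<close>. The bidegree of W has weight
zero and lies in the semigroup, so the weight of z cannot be positive, which means
\<open>r d = P n\<close>. The bidegrees of \<open>\<delta> x\<close> and \<open>\<delta> y\<close> are natural
combinations of the bidegrees of the generators with weights \<open>P - 1\<close> and \<open>r - 1\<close>. So \<open>\<delta> x\<close>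
involves only y and z, and \<open>\<delta> y\<close> only x and z. As both are shifted by the same vector, comparing
them forces y to occur in \<open>\<delta> x\<close> (because \<open>d \<ge> 2\<close>) and x to occur in \<open>\<delta> y\<close> (because \<open>n \<ge> 2\<close>),
that is, \<open>P > r > P\<close>.
\<close>

theorem kernel_of_lnd:
  assumes \<delta>: "derivation \<delta>" and nil: "\<And>f. f \<in> B \<Longrightarrow> \<exists>r. (\<delta> ^^ r) f = 0"
    and nz: "f0 \<in> B" "\<delta> f0 \<noteq> 0" and W: "W \<in> B" "\<delta> W = 0"
  shows "degree W = 0"
proof (rule ccontr)
  assume deg: "degree W \<noteq> 0"
  define a where "a = degree W"
  define p where "p = fls_subdegree (lead_coeff W)"
  have a: "a > 0" and LW: "leads W a p"
    using deg by (auto simp: a_def p_def leads_iff)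
  \<comment> \<open>otherwise the Jacobian formula makes the whole derivation vanish\<close>
  have "\<delta> xfun \<noteq> 0"
  proof
    assume "\<delta> xfun = 0"
    then have "euler_y W * \<delta> f0 = 0" using derivation_jacobian[OF \<delta> W nz(1)] by simp
    moreover have "euler_y W \<noteq> 0" using leads_euler_y[OF LW a] by (simp add: leads_iff)
    ultimately show False using nz by simp
  qed
  then obtain e g where dx: "leads (\<delta> xfun) e g" by (auto simp: leads_iff)
  define N where "N = int a * (g + 1) - p * int e"
  define n where "n = int (degree c)"
  define d where "d = int (degree q)"
  have nd: "n \<ge> 2" "d \<ge> 2" using degree_c degree_q by (auto simp: n_def d_def)
  have wedge: "\<exists>j::nat. p * int m - int a * i = int j * N" if "f \<in> B" "leads f m i" for f m i
    unfolding N_def using nil[OF that(1)] nilpotent_wedge[OF \<delta> W LW a dx that] by blast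
  have Lx: "leads xfun 0 (-1)" and Ly: "leads yfun 1 0"
    by (simp_all add: leads_iff)
  have Lz: "leads zfun (degree q) n"
    using lead_coeff_zfun by (simp add: leads_iff n_def)
  obtain P :: nat where P: "int a = int P * N" using wedge[OF xfun_in_B Lx] by auto
  have N: "N > 0" and P0: "P > 0"
  proof -
    have "int P * N > 0" using P a by simp
    then show "N > 0" "P > 0" by (auto simp: zero_less_mult_iff)
  qed
  obtain r :: nat where r: "p = int r * N" using wedge[OF yfun_in_B Ly] by auto
  \<comment> \<open>z has weight 0: nonnegative by local nilpotency, nonpositive since the bidegree of W lies in the semigroup\<close>
  have "p * d = int a * n"
  proof (rule antisym)
    obtain j l k where ap: "a = j + degree q * k" "p = n * int k - int l"
      using B_leads[OF W(1) LW] unfolding n_def by blast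
    then have "int a = int j + d * int k" by (simp add: d_def)
    then have "int a * n - p * d = int j * n + int l * d"
      unfolding ap(2) by (simp add: algebra_simps)
    moreover have "int j * n + int l * d \<ge> 0" using nd by simp
    ultimately show "p * d \<le> int a * n" by linarith
    obtain j :: nat where "p * d - int a * n = int j * N"
      using wedge[OF zfun_in_B Lz] by (auto simp: d_def)
    moreover have "int j * N \<ge> 0" using N by simp
    ultimately show "int a * n \<le> p * d" by linarith
  qed
  then have rP: "int r * d = int P * n" using P r N by auto
  then have r0: "r > 0" using P0 nd by (cases "r = 0") auto
  obtain j l k where dx': "e = j + degree q * k" "g = n * int k - int l"
    using B_leads[OF _ dx] derivation_rules(1)[OF \<delta> xfun_in_B] unfolding n_def by blast
  have "leads (\<delta> yfun) (1 + e) (0 + g + 1)"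
    using leads_derivation[OF \<delta> W LW a dx yfun_in_B Ly] r r0 N by simp
  then obtain j' l' k' where dy': "1 + e = j' + degree q * k'" "0 + g + 1 = n * int k' - int l'"
    using B_leads derivation_rules(1)[OF \<delta> yfun_in_B] unfolding n_def by metis
  have e: "int e = int j + d * int k" and e': "1 + int e = int j' + d * int k'"
    using dx'(1) dy'(1) unfolding d_def by (metis of_nat_add of_nat_mult of_nat_1)+
  \<comment> \<open>the two weight identities below both rest on this form of the definition of N\<close>
  have NN: "N = int P * N * (g + 1) - int r * N * int e"
    using N_def unfolding P r .
  have "int P - 1 = int r * int j + int P * int l"
  proof -
    have "(int P - 1) * N - (int r * N * int e - int P * N * g)
        = (int P * N * (g + 1) - int r * N * int e) - N"
      by (simp add: algebra_simps)
    then have "(int P - 1) * N = int r * N * int e - int P * N * g"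
      using NN by linarith
    also have "\<dots> = (int r * int j + int P * int l + k * (int r * d - int P * n)) * N"
      unfolding e dx'(2) by (simp add: algebra_simps)
    finally show ?thesis using N rP by simp
  qed
  moreover have "int r - 1 = int r * int j' + int P * int l'"
  proof -
    have "(int r - 1) * N = int r * N * (1 + int e) - int P * N * (0 + g + 1)"
    proof -
      have "(int r - 1) * N - (int r * N * (1 + int e) - int P * N * (0 + g + 1))
          = (int P * N * (g + 1) - int r * N * int e) - N"
        by (simp add: algebra_simps)
      then show ?thesis using NN by linarith
    qed
    also have "\<dots> = (int r * int j' + int P * int l' + k' * (int r * d - int P * n)) * N"
      unfolding e' dy'(2) by (simp add: algebra_simps)
    finally show ?thesis using N rP by simp
  qed
  ultimately have Pj: "P = r * j + P * l + 1" and rl: "r = r * j' + P * l' + 1"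
    by (simp_all flip: of_nat_mult of_nat_add)
  have "l = 0" using Pj P0 by (cases l) auto
  have "j' = 0" using rl r0 by (cases j') auto
  have t: "int j + 1 = d * (int k' - int k)" "int l' + 1 = n * (int k' - int k)"
    using e e' dx'(2) dy'(2) \<open>l = 0\<close> \<open>j' = 0\<close> by (simp_all add: algebra_simps)
  have "int k' - int k > 0"
    using t(1) nd by (metis (no_types) add_pos_nonneg add.commute of_nat_0_le_iff
      zero_less_one zero_less_mult_pos less_le_trans zero_less_numeral)
  then have "d * (int k' - int k) \<ge> 2 * 1" "n * (int k' - int k) \<ge> 2 * 1"
    using nd by (intro mult_mono; simp)+
  then have "j \<ge> 1" "l' \<ge> 1" using t by linarith+
  then have "r * j \<ge> r" "P * l' \<ge> P" by simp_all
  then show False using Pj rl by linarith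
qed

end

section \<open>Automorphisms: the form of their action on x and y\<close>

lemma coeff_pcompose_linear_top:
  fixes p :: "'a::comm_ring_1 poly"
  assumes "degree p \<le> m"
  shows "coeff (p \<circ>\<^sub>p [:v, u:]) m = u ^ m * coeff p m"
  using assms
proof (induction p arbitrary: m)
  case (pCons a p)
  show ?case
  proof (cases m)
    case 0
    then have "p = 0" using pCons.prems by (auto split: if_splits)
    then show ?thesis using 0 by (simp add: pcompose_pCons)
  next
    case (Suc m')
    have d: "degree p \<le> m'" using pCons.prems Suc by (auto split: if_splits)
    have "coeff (p \<circ>\<^sub>p [:v, u:]) (Suc m') = 0"
      using pCons.IH[of "Suc m'"] d by (simp add: coeff_eq_0)
    then show ?thesis using Suc pCons.IH[OF d] by (simp add: pcompose_pCons algebra_simps)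
  qed
qed simp

text \<open>
This measures how much an affine substitution destroys centeredness, which is how the translation
parts of automorphisms are controlled.
\<close>

lemma coeff_pcompose_linear_subtop:
  fixes p :: "'a::comm_ring_1 poly"
  assumes "degree p \<le> Suc m"
  shows "coeff (p \<circ>\<^sub>p [:v, u:]) m = u ^ m * (coeff p m + of_nat (Suc m) * v * coeff p (Suc m))"
  using assms
proof (induction p arbitrary: m)
  case (pCons a p)
  have d: "degree p \<le> m" using pCons.prems by (auto split: if_splits)
  show ?case
  proof (cases m)
    case 0
    then obtain b where "p = [:b:]" using d by (auto elim: degree_eq_zeroE)
    then show ?thesis using 0 by (simp add: pcompose_pCons)
  next
    case (Suc m')
    then show ?thesis
      using pCons.IH[of m'] d coeff_pcompose_linear_top[of p "Suc m'" v u]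
      by (simp add: pcompose_pCons algebra_simps)
  qed
qed simp

lemma degree_le_1_cases:
  assumes "degree p \<le> 1"
  shows "\<exists>a b. p = [:a, b:]"
proof -
  obtain a p' where p: "p = pCons a p'" by (cases p)
  then have "degree p' = 0" using assms by (auto split: if_splits)
  then obtain b where "p' = [:b:]" by (rule degree_eq_zeroE)
  with p show ?thesis by blast
qed

lemma dvd_pcompose_diff:
  fixes P :: "'a::comm_ring_1 poly"
  assumes "b dvd R - S"
  shows "b dvd P \<circ>\<^sub>p R - P \<circ>\<^sub>p S"
proof (induction P)
  case (pCons a P)
  have "pCons a P \<circ>\<^sub>p R - pCons a P \<circ>\<^sub>p S = (R - S) * (P \<circ>\<^sub>p R) + S * (P \<circ>\<^sub>p R - P \<circ>\<^sub>p S)"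
    by (simp add: pcompose_pCons algebra_simps)
  also have "b dvd \<dots>" using assms pCons by (intro dvd_add dvd_mult dvd_mult2)
  finally show ?case .
qed simp

context danielewski
begin

definition endo :: "('k fls poly \<Rightarrow> 'k fls poly) \<Rightarrow> bool" where
  "endo \<sigma> \<longleftrightarrow> (\<forall>f\<in>B. \<sigma> f \<in> B) \<and> (\<forall>f\<in>B. \<forall>g\<in>B. \<sigma> (f + g) = \<sigma> f + \<sigma> g)
     \<and> (\<forall>f\<in>B. \<forall>g\<in>B. \<sigma> (f * g) = \<sigma> f * \<sigma> g) \<and> (\<forall>a. \<sigma> (scalar a) = scalar a)"

lemma endo_rules:
  assumes "endo \<sigma>"
  shows "f \<in> B \<Longrightarrow> \<sigma> f \<in> B" "f \<in> B \<Longrightarrow> g \<in> B \<Longrightarrow> \<sigma> (f + g) = \<sigma> f + \<sigma> g"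
    "f \<in> B \<Longrightarrow> g \<in> B \<Longrightarrow> \<sigma> (f * g) = \<sigma> f * \<sigma> g" "\<sigma> (scalar a) = scalar a" "\<sigma> 0 = 0"
proof -
  show "f \<in> B \<Longrightarrow> \<sigma> f \<in> B" "f \<in> B \<Longrightarrow> g \<in> B \<Longrightarrow> \<sigma> (f + g) = \<sigma> f + \<sigma> g"
    "f \<in> B \<Longrightarrow> g \<in> B \<Longrightarrow> \<sigma> (f * g) = \<sigma> f * \<sigma> g" and sc: "\<sigma> (scalar a) = scalar a" for a
    using assms by (auto simp: endo_def)
  show "\<sigma> 0 = 0" using sc[of 0] by simp
qed

definition mutually_inverse :: "('k fls poly \<Rightarrow> 'k fls poly) \<Rightarrow> ('k fls poly \<Rightarrow> 'k fls poly) \<Rightarrow> bool" where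
  "mutually_inverse \<sigma> \<tau> \<longleftrightarrow> endo \<sigma> \<and> endo \<tau> \<and> (\<forall>f\<in>B. \<sigma> (\<tau> f) = f) \<and> (\<forall>f\<in>B. \<tau> (\<sigma> f) = f)"

lemma mutually_inverse_sym: "mutually_inverse \<sigma> \<tau> \<Longrightarrow> mutually_inverse \<tau> \<sigma>"
  by (simp add: mutually_inverse_def)

lemma endo_at_inf:
  assumes \<sigma>: "endo \<sigma>" "\<sigma> xfun = [:at_inf h:]"
  shows "\<sigma> [:at_inf p:] = [:at_inf (p \<circ>\<^sub>p h):]"
proof (induction p)
  case 0
  then show ?case by (simp add: endo_rules[OF \<sigma>(1)])
next
  case (pCons a p)
  have "[:at_inf (pCons a p):] = scalar a + xfun * [:at_inf p:]"
    by (simp add: at_inf_pCons)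
  then have "\<sigma> [:at_inf (pCons a p):] = scalar a + [:at_inf h:] * [:at_inf (p \<circ>\<^sub>p h):]"
    using pCons \<sigma>
    by (simp only: endo_rules[OF \<sigma>(1)] scalar_in_B xfun_in_B at_inf_in_B B_closed)
  also have "\<dots> = [:at_inf (pCons a p \<circ>\<^sub>p h):]"
    by (simp add: pcompose_pCons at_inf_const)
  finally show ?case .
qed

lemma kxy_pCons_sum: "kxy (pCons p P) = [:at_inf p:] + yfun * kxy P"
  by simp

lemma endo_kxy:
  assumes \<sigma>: "endo \<sigma>" "\<sigma> xfun = [:at_inf h:]" "\<sigma> yfun = kxy w"
  shows "\<sigma> (kxy P) = kxy (map_poly (\<lambda>p. p \<circ>\<^sub>p h) P \<circ>\<^sub>p w)"
proof (induction P)
  case 0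
  then show ?case by (simp add: endo_rules[OF \<sigma>(1)])
next
  case (pCons p P)
  have "\<sigma> (kxy (pCons p P)) = [:at_inf (p \<circ>\<^sub>p h):] + kxy w * kxy (map_poly (\<lambda>p. p \<circ>\<^sub>p h) P \<circ>\<^sub>p w)"
    using pCons \<sigma> unfolding kxy_pCons_sum
    by (simp only: endo_rules[OF \<sigma>(1)] yfun_in_B kxy_in_B at_inf_in_B B_closed endo_at_inf[OF \<sigma>(1,2)])
  also have "\<dots> = kxy (map_poly (\<lambda>p. p \<circ>\<^sub>p h) (pCons p P) \<circ>\<^sub>p w)"
    using pCons(1) by (simp add: map_poly_pCons pcompose_pCons)
  finally show ?case .
qed

lemma endo_eqI:
  assumes \<sigma>: "endo \<sigma>" and \<tau>: "endo \<tau>" and x: "\<sigma> xfun = \<tau> xfun" and y: "\<sigma> yfun = \<tau> yfun"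
    and nz: "\<sigma> [:at_inf c:] \<noteq> 0" and f: "f \<in> B"
  shows "\<sigma> f = \<tau> f"
proof -
  note E = endo_rules[OF \<sigma>] endo_rules[OF \<tau>]
  have xy: "\<sigma> (kxy P) = \<tau> (kxy P)" for P
    by (rule xy_induct[where S = "\<lambda>f. \<sigma> f = \<tau> f"]) (simp_all add: E kxy_in_B x y)
  have "\<sigma> ([:at_inf c:] * zfun) = \<tau> ([:at_inf c:] * zfun)" using xy[of q] by (simp add: c_zfun)
  moreover have "\<sigma> [:at_inf c:] = \<tau> [:at_inf c:]" using xy[of "[:c:]"] by simp
  ultimately have "\<sigma> [:at_inf c:] * \<sigma> zfun = \<sigma> [:at_inf c:] * \<tau> zfun"
    by (simp only: E at_inf_in_B zfun_in_B)
  then have z: "\<sigma> zfun = \<tau> zfun" unfolding mult_left_cancel[OF nz] .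
  show ?thesis using f by (induction rule: B_induct) (simp_all add: E x y z)
qed

text \<open>
Every element of \<open>B\<close> lies in \<open>k[x,y]\<close> up to a power of c. This reduces statements about
homomorphisms to their values on x and y.
\<close>

lemma clear_denominators:
  assumes "f \<in> B"
  shows "\<exists>k P. [:at_inf (c ^ k):] * f = kxy P"
  using assms
proof (induction rule: B_induct)
  case (scalar a)
  show ?case by (rule exI[of _ 0], rule exI[of _ "[:[:a:]:]"]) (simp add: at_inf_const)
next
  case x
  show ?case by (rule exI[of _ 0], rule exI[of _ "[:[:0,1:]:]"]) (simp add: at_inf_X)
next
  case y
  show ?case by (rule exI[of _ 0], rule exI[of _ "[:0,1:]"]) simp
next
  case z
  show ?case by (rule exI[of _ 1], rule exI[of _ q]) (simp add: c_zfun)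
next
  case (add f g)
  then obtain k P l Q where kl: "[:at_inf (c ^ k):] * f = kxy P" "[:at_inf (c ^ l):] * g = kxy Q"
    by blast
  have "[:at_inf (c ^ (k + l)):] * (f + g)
      = [:at_inf (c ^ l):] * ([:at_inf (c ^ k):] * f) + [:at_inf (c ^ k):] * ([:at_inf (c ^ l):] * g)"
    by (simp add: power_add smult_add_right mult.commute)
  also have "\<dots> = kxy ([:c ^ l:] * P + [:c ^ k:] * Q)"
    unfolding kl by simp
  finally show ?case by blast
next
  case (mult f g)
  then obtain k P l Q where kl: "[:at_inf (c ^ k):] * f = kxy P" "[:at_inf (c ^ l):] * g = kxy Q"
    by blast
  have "[:at_inf (c ^ (k + l)):] * (f * g) = ([:at_inf (c ^ k):] * f) * ([:at_inf (c ^ l):] * g)"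
    by (simp add: power_add mult.commute)
  also have "\<dots> = kxy (P * Q)"
    unfolding kl by simp
  finally show ?case by blast
qed

lemma B_degree_0:
  assumes "f \<in> B" "degree f = 0"
  shows "\<exists>p. f = [:at_inf p:]"
proof -
  have "degree f < degree q" using assms(2) degree_q by simp
  then obtain P where P: "f = kxy P" using B_degree_less[OF assms(1)] by blast
  then have "degree P = 0" using assms by simp
  then obtain p where "P = [:p:]" by (rule degree_eq_zeroE)
  with P show ?thesis by auto
qed

text \<open>
The locally nilpotent derivation \<open>\<xi>\<close> with \<open>\<xi> x = 0\<close>, \<open>\<xi> y = c\<close>; it is \<open>c d/dy\<close>.
\<close>

definition lnd :: "'k fls poly \<Rightarrow> 'k fls poly" where
  "lnd f = [:at_inf c:] * pderiv f"

lemma pderiv_kxy: "pderiv (kxy P) = kxy (pderiv P)"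
proof (induction P)
  case (pCons p P)
  then show ?case by (simp add: pderiv_pCons)
qed simp

lemma lnd_in_B: "f \<in> B \<Longrightarrow> lnd f \<in> B"
proof (induction rule: B_induct)
  case z
  have "lnd zfun = kxy (pderiv q)"
    by (simp add: lnd_def zfun_def pderiv_smult pderiv_kxy)
  then show ?case using kxy_in_B by simp
next
  case (add f g)
  have "lnd (f + g) = lnd f + lnd g" by (simp add: lnd_def pderiv_add smult_add_right)
  then show ?case using add B_closed by simp
next
  case (mult f g)
  have "lnd (f * g) = f * lnd g + g * lnd f" by (simp add: lnd_def pderiv_mult smult_add_right)
  then show ?case using mult B_closed by simp
qed (use at_inf_in_B[of c] at_inf_in_B[of 0] in \<open>simp_all add: lnd_def pderiv_pCons\<close>)

lemma derivation_lnd: "derivation lnd"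
  unfolding derivation_def
  by (auto simp: lnd_in_B)
    (simp_all add: lnd_def pderiv_add pderiv_mult smult_add_right pderiv_pCons mult.commute)

lemma lnd_nilpotent: "(lnd ^^ Suc (degree f)) f = 0"
proof (induction "degree f" arbitrary: f)
  case 0
  then obtain a where "f = [:a:]" by (metis degree_eq_zeroE)
  then show ?case by (simp add: lnd_def pderiv_pCons)
next
  case (Suc n)
  have "degree (lnd f) = n"
    using Suc.hyps(2) by (simp add: lnd_def degree_pderiv)
  then have "(lnd ^^ Suc n) (lnd f) = 0" using Suc.hyps(1)[of "lnd f"] by simp
  then show ?case unfolding Suc.hyps(2)[symmetric] funpow_Suc_right[of "Suc n"] o_apply .
qed

text \<open>
Conjugating \<open>\<xi>\<close> by the automorphism gives another nonzero locally nilpotent derivation, and it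
kills the image of x.
\<close>

lemma degree_aut_x:
  assumes "mutually_inverse \<sigma> \<tau>"
  shows "degree (\<sigma> xfun) = 0"
proof -
  have \<sigma>: "endo \<sigma>" and \<tau>: "endo \<tau>" and inv: "\<And>f. f \<in> B \<Longrightarrow> \<sigma> (\<tau> f) = f" "\<And>f. f \<in> B \<Longrightarrow> \<tau> (\<sigma> f) = f"
    using assms by (auto simp: mutually_inverse_def)
  note E = endo_rules[OF \<sigma>] endo_rules[OF \<tau>] and D = derivation_rules[OF derivation_lnd]
  define \<delta> where "\<delta> = (\<lambda>f. \<sigma> (lnd (\<tau> f)))"
  have "derivation \<delta>"
    unfolding derivation_def \<delta>_def by (auto simp: E D B_closed inv)
  moreover have "\<exists>r. (\<delta> ^^ r) f = 0" if f: "f \<in> B" for f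
  proof -
    have "(\<delta> ^^ r) f = \<sigma> ((lnd ^^ r) (\<tau> f)) \<and> (lnd ^^ r) (\<tau> f) \<in> B" for r
      by (induction r) (use f in \<open>auto simp: inv E D \<delta>_def\<close>)
    then show ?thesis using lnd_nilpotent[of "\<tau> f"] E(5) by metis
  qed
  moreover have dx: "\<delta> (\<sigma> xfun) = 0"
    using E by (simp add: \<delta>_def inv xfun_in_B lnd_def pderiv_pCons)
  have "\<delta> (\<sigma> yfun) \<noteq> 0"
  proof
    assume 0: "\<delta> (\<sigma> yfun) = 0"
    have "\<delta> (\<sigma> yfun) = \<sigma> [:at_inf c:]"
      by (simp add: \<delta>_def inv yfun_in_B lnd_def pderiv_pCons)
    then have "[:at_inf c:] = \<tau> 0" using 0 inv(2)[OF at_inf_in_B] by metis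
    then show False using E by simp
  qed
  moreover note dx
  ultimately show ?thesis
    by (rule kernel_of_lnd[OF _ _ E(1)[OF yfun_in_B] _ E(1)[OF xfun_in_B]])
qed

lemma aut_x_linear:
  assumes "mutually_inverse \<sigma> \<tau>"
  obtains b e where "\<sigma> xfun = [:at_inf [:b, e:]:]" "e \<noteq> 0"
proof -
  have \<sigma>: "endo \<sigma>" and \<tau>: "endo \<tau>" and inv: "\<And>f. f \<in> B \<Longrightarrow> \<sigma> (\<tau> f) = f"
    using assms by (auto simp: mutually_inverse_def)
  obtain h where h: "\<sigma> xfun = [:at_inf h:]"
    using B_degree_0[OF endo_rules(1)[OF \<sigma> xfun_in_B] degree_aut_x[OF assms]] by blast
  obtain h' where h': "\<tau> xfun = [:at_inf h':]"
    using B_degree_0[OF endo_rules(1)[OF \<tau> xfun_in_B]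
        degree_aut_x[OF mutually_inverse_sym[OF assms]]] by blast
  have "[:at_inf (h' \<circ>\<^sub>p h):] = [:at_inf [:0, 1:]:]"
    using inv[OF xfun_in_B] unfolding h' endo_at_inf[OF \<sigma> h] at_inf_X .
  then have "h' \<circ>\<^sub>p h = [:0, 1:]" by simp
  then have "degree (h' \<circ>\<^sub>p h) = 1" by simp
  then have "degree h = 1" by (simp add: degree_pcompose)
  then obtain b e where be: "h = [:b, e:]" using degree_le_1_cases[of h] by auto
  have "e \<noteq> 0" using \<open>degree h = 1\<close> be by auto
  with h show ?thesis unfolding be by (rule that)
qed

lemma degree_endo_kxy:
  assumes \<sigma>: "endo \<sigma>" "\<sigma> xfun = [:at_inf h:]" "degree h > 0" and pos: "degree (\<sigma> yfun) > 0"
    and P: "P \<noteq> 0"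
  shows "\<sigma> (kxy P) \<noteq> 0 \<and> degree (\<sigma> (kxy P)) = degree (\<sigma> yfun) * degree P"
  using P
proof (induction P)
  case (pCons p P)
  have eq: "\<sigma> (kxy (pCons p P)) = [:at_inf (p \<circ>\<^sub>p h):] + \<sigma> yfun * \<sigma> (kxy P)"
    unfolding kxy_pCons_sum
    by (simp only: endo_rules[OF \<sigma>(1)] yfun_in_B kxy_in_B at_inf_in_B B_closed endo_at_inf[OF \<sigma>(1,2)])
  show ?case
  proof (cases "P = 0")
    case True
    then have "p \<circ>\<^sub>p h \<noteq> 0" using pCons \<sigma>(3) by (simp add: pcompose_eq_0_iff)
    then show ?thesis unfolding eq using True by (simp add: endo_rules[OF \<sigma>(1)])
  next
    case False
    with pCons have IH: "\<sigma> (kxy P) \<noteq> 0" "degree (\<sigma> (kxy P)) = degree (\<sigma> yfun) * degree P" by auto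
    have "degree (\<sigma> yfun * \<sigma> (kxy P)) = degree (\<sigma> yfun) + degree (\<sigma> yfun) * degree P"
      using IH pos by (subst degree_mult_eq) auto
    moreover from this have "degree (\<sigma> (kxy (pCons p P))) = degree (\<sigma> yfun * \<sigma> (kxy P))"
      unfolding eq using pos by (intro degree_add_eq_right) simp
    ultimately show ?thesis using False pos by auto
  qed
qed simp

text \<open>
The automorphism multiplies y-degrees of elements of k[x,y] by the y-degree b of the image of y.
Since y itself is, up to a factor from k[x], the image of such an element, b divides 1.
\<close>

lemma degree_aut_y:
  assumes "mutually_inverse \<sigma> \<tau>"
  shows "degree (\<sigma> yfun) = 1"
proof -
  have \<sigma>: "endo \<sigma>" and \<tau>: "endo \<tau>" and inv: "\<And>f. f \<in> B \<Longrightarrow> \<sigma> (\<tau> f) = f"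
    using assms by (auto simp: mutually_inverse_def)
  note E = endo_rules[OF \<sigma>]
  obtain b e where be: "\<sigma> xfun = [:at_inf [:b, e:]:]" "e \<noteq> 0" by (rule aut_x_linear[OF assms])
  have \<tau>y: "\<tau> yfun \<in> B" using endo_rules(1)[OF \<tau> yfun_in_B] .
  obtain k P where kP: "[:at_inf (c ^ k):] * \<tau> yfun = kxy P"
    using clear_denominators[OF \<tau>y] by blast
  then have "\<sigma> (kxy P) = [:at_inf (c ^ k \<circ>\<^sub>p [:b, e:]):] * yfun"
    using E(3)[OF at_inf_in_B \<tau>y, of "c ^ k"] inv[OF yfun_in_B] endo_at_inf[OF \<sigma> be(1)] by simp
  moreover have "c ^ k \<circ>\<^sub>p [:b, e:] \<noteq> 0" using be(2) by (simp add: pcompose_eq_0_iff)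
  ultimately have deg1: "degree (\<sigma> (kxy P)) = 1" by simp
  have "degree (\<sigma> yfun) > 0"
  proof (rule ccontr)
    assume y0: "\<not> degree (\<sigma> yfun) > 0"
    have "degree (\<sigma> (kxy P)) = 0" for P
    proof (rule xy_induct[where S = "\<lambda>f. degree (\<sigma> f) = 0"])
      show "degree (\<sigma> (kxy P + kxy Q)) = 0"
        if "degree (\<sigma> (kxy P)) = 0" "degree (\<sigma> (kxy Q)) = 0" for P Q
        using that degree_add_le[of "\<sigma> (kxy P)" 0 "\<sigma> (kxy Q)"] by (simp add: E kxy_in_B)
      show "degree (\<sigma> (kxy P * kxy Q)) = 0"
        if "degree (\<sigma> (kxy P)) = 0" "degree (\<sigma> (kxy Q)) = 0" for P Q
        using that degree_mult_le[of "\<sigma> (kxy P)" "\<sigma> (kxy Q)"] by (simp add: E kxy_in_B)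
    qed (use y0 be in \<open>simp_all add: E\<close>)
    with deg1 show False by simp
  qed
  then have "degree (\<sigma> yfun) * degree P = 1"
    using degree_endo_kxy[OF \<sigma> be(1), of P] be(2) deg1 by (cases "P = 0") (auto simp: E)
  then show ?thesis by simp
qed

text \<open>
The coefficient of y is a unit of k[x] because the inverse automorphism is linear in y as well.
\<close>

lemma aut_y_linear:
  assumes "mutually_inverse \<sigma> \<tau>"
  obtains v u where "\<sigma> yfun = kxy [:v, [:u:]:]" "u \<noteq> 0"
proof -
  have linear: "\<exists>v u. \<sigma> yfun = kxy [:v, u:]" if A: "mutually_inverse \<sigma> \<tau>" for \<sigma> \<tau>
  proof -
    have "\<sigma> yfun \<in> B" using A endo_rules(1)[OF _ yfun_in_B] by (auto simp: mutually_inverse_def)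
    moreover have "degree (\<sigma> yfun) < degree q" using degree_aut_y[OF A] degree_q by simp
    ultimately obtain P where P: "\<sigma> yfun = kxy P" using B_degree_less by blast
    then have "degree P = 1" using degree_aut_y[OF A] by simp
    then obtain v u where "P = [:v, u:]" using degree_le_1_cases[of P] by auto
    with P show ?thesis by blast
  qed
  have \<sigma>: "endo \<sigma>" and \<tau>: "endo \<tau>" and inv: "\<And>f. f \<in> B \<Longrightarrow> \<sigma> (\<tau> f) = f"
    using assms by (auto simp: mutually_inverse_def)
  obtain b e where be: "\<sigma> xfun = [:at_inf [:b, e:]:]" "e \<noteq> 0" by (rule aut_x_linear[OF assms])
  obtain v u where vu: "\<sigma> yfun = kxy [:v, u:]" using linear[OF assms] by blast
  obtain v' u' where vu': "\<tau> yfun = kxy [:v', u':]"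
    using linear[OF mutually_inverse_sym[OF assms]] by blast
  have "kxy (map_poly (\<lambda>p. p \<circ>\<^sub>p [:b, e:]) [:v', u':] \<circ>\<^sub>p [:v, u:]) = kxy [:0, 1:]"
    using inv[OF yfun_in_B] unfolding vu' endo_kxy[OF \<sigma> be(1) vu] by simp
  then have "map_poly (\<lambda>p. p \<circ>\<^sub>p [:b, e:]) [:v', u':] \<circ>\<^sub>p [:v, u:] = [:0, 1:]"
    by (simp only: kxy_eq_iff)
  then have "coeff (map_poly (\<lambda>p. p \<circ>\<^sub>p [:b, e:]) [:v', u':] \<circ>\<^sub>p [:v, u:]) 1 = 1" by simp
  then have "(u' \<circ>\<^sub>p [:b, e:]) * u = 1"
    by (simp add: map_poly_pCons pcompose_pCons)
  then have "u dvd 1" by (metis dvd_triv_right)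
  then have "\<exists>u0. u = [:u0:] \<and> u0 \<noteq> 0"
    unfolding is_unit_poly_iff by auto
  then obtain u0 where "u = [:u0:]" "u0 \<noteq> 0"
    by blast
  with vu that[of v u0] show ?thesis by simp
qed

end

locale reduced_danielewski = danielewski +
  assumes reduced: "reduced_form c q"
begin

text \<open>
An automorphism acts affinely, \<open>x \<mapsto> e x + b\<close> and \<open>y \<mapsto> u y + v\<close>. Its value at z has
y-degree \<open>degree q\<close>, hence the form \<open>r + s z\<close>, and the relation \<open>c z = q\<close> becomes a polynomial
identity. Its leading coefficient in y says that \<open>c(e x + b)\<close> is proportional to c, and
\<open>b = 0\<close> follows as c is centered. The next coefficient gives \<open>c dvd v\<close> as q is
centered. Modulo c the identity now reads \<open>q(e x, u y) = u\<^sup>d q\<close>, and it holds on the nose because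
all x-degrees are below the degree of c.
\<close>

theorem aut_structure:
  assumes A: "mutually_inverse \<sigma> \<tau>"
  obtains e u l where "e \<noteq> 0" "u \<noteq> 0"
    "c \<circ>\<^sub>p [:0, e:] = smult (e ^ degree c) c"
    "subst_xy e u q = smult [:u ^ degree q:] q"
    "\<sigma> xfun = scalar e * xfun"
    "\<sigma> yfun = scalar u * yfun + [:at_inf c:] * [:at_inf l:]"
proof -
  have \<sigma>: "endo \<sigma>" using assms by (auto simp: mutually_inverse_def)
  note E = endo_rules[OF \<sigma>]
  obtain b e where be: "\<sigma> xfun = [:at_inf [:b, e:]:]" and e: "e \<noteq> 0" by (rule aut_x_linear[OF assms])
  obtain v u where vu: "\<sigma> yfun = kxy [:v, [:u:]:]" and u: "u \<noteq> 0" by (rule aut_y_linear[OF assms])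
  define ce where "ce = c \<circ>\<^sub>p [:b, e:]"
  define q1 where "q1 = map_poly (\<lambda>p. p \<circ>\<^sub>p [:b, e:]) q"
  define q2 where "q2 = q1 \<circ>\<^sub>p [:v, [:u:]:]"
  obtain a where a: "a \<noteq> 0" "lead_coeff q = [:a:]" by (rule lead_coeff_q)
  have degce: "degree ce = degree c" using e by (simp add: ce_def degree_pcompose)
  then have ce0: "ce \<noteq> 0" using degree_c by auto
  have q1: "degree q1 \<le> degree q" "coeff q1 (degree q) = [:a:]" and coeff_q1: "coeff q1 i = coeff q i \<circ>\<^sub>p [:b, e:]" for i
    using a by (auto simp: q1_def coeff_map_poly coeff_eq_0 intro!: degree_le)
  have q2: "degree q2 \<le> degree q" "coeff q2 (degree q) = [:u ^ degree q * a:]"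
    using coeff_pcompose_linear_top[OF q1(1), of v "[:u:]"] q1
    by (auto simp: q2_def degree_pcompose u poly_const_pow)
  have cez: "[:at_inf ce:] * \<sigma> zfun = kxy q2"
  proof -
    have "\<sigma> ([:at_inf c:] * zfun) = kxy q2"
      using endo_kxy[OF \<sigma> be vu, of q] by (simp add: c_zfun q1_def q2_def)
    then show ?thesis
      by (simp only: E(3)[OF at_inf_in_B zfun_in_B] endo_at_inf[OF \<sigma> be] ce_def)
  qed
  have "degree (\<sigma> zfun) = degree q"
  proof -
    have "degree q2 = degree q" using q2 u a le_degree[of q2 "degree q"] by (intro antisym) auto
    then show ?thesis using arg_cong[OF cez, of degree] ce0 by simp
  qed
  then obtain r s where rs: "\<sigma> zfun = kxy r + smult (at_inf s) zfun" "degree r < degree q"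
    using B_degree_zfun[OF E(1)[OF zfun_in_B]] by blast
  have "kxy (smult ce (smult c r + smult s q)) = kxy (smult c q2)"
  proof -
    have "kxy (smult ce (smult c r + smult s q))
        = smult (at_inf c) ([:at_inf ce:] * (kxy r + smult (at_inf s) zfun))"
      unfolding kxy_hom kxy_smult c_zfun[symmetric] by (simp add: smult_add_right mult_ac)
    also have "\<dots> = smult (at_inf c) (kxy q2)" using cez unfolding rs(1) by (simp only:)
    finally show ?thesis by simp
  qed
  then have main: "smult ce (smult c r + smult s q) = smult c q2" by (simp only: kxy_eq_iff)
  have "ce * s = smult (u ^ degree q) c"
  proof -
    have "coeff (smult ce (smult c r + smult s q)) (degree q) = ce * s * [:a:]"
      using rs(2) a by (simp add: coeff_eq_0)
    then have "ce * s * [:a:] = smult (u ^ degree q) c * [:a:]"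
      unfolding main using q2(2) by (simp add: mult.commute)
    then show ?thesis using a(1) by (subst (asm) mult_right_cancel) auto
  qed
  moreover from this have s0: "s \<noteq> 0" using u by auto
  ultimately have "degree c + degree s = degree c"
    using degree_mult_eq[OF ce0 s0] degce u by simp
  then obtain s' where s': "s = [:s':]" by (auto elim: degree_eq_zeroE)
  have "s' \<noteq> 0" using s0 s' by auto
  have ce_s': "smult s' ce = smult (u ^ degree q) c"
    using \<open>ce * s = _\<close> s' by simp
  have "lead_coeff ce = e ^ degree c * lead_coeff c"
    using e unfolding ce_def by (simp add: lead_coeff_comp mult.commute)
  then have s'u: "s' * e ^ degree c = u ^ degree q"
    using arg_cong[OF ce_s', of "\<lambda>p. coeff p (degree c)"] degce by simp
  have "smult s' ce = smult s' (smult (e ^ degree c) c)"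
    unfolding smult_smult s'u by (rule ce_s')
  then have ce: "ce = smult (e ^ degree c) c" by (rule smult_cancel[OF \<open>s' \<noteq> 0\<close>])
  have b: "b = 0"
  proof -
    obtain m where m: "degree c = Suc m" using degree_c by (cases "degree c") auto
    have "coeff c m = 0" using reduced m by (simp add: reduced_form_def centered_def)
    then have "e ^ m * (of_nat (Suc m) * b * lead_coeff c) = 0"
      using coeff_pcompose_linear_subtop[of c m b e] ce m unfolding ce_def by simp
    then show ?thesis using e by (simp del: of_nat_Suc)
  qed
  have q2_eq: "q2 = smult [:u ^ degree q:] q + [:c:] * smult [:e ^ degree c:] r"
  proof -
    have "smult c (smult [:e ^ degree c:] (smult c r + smult s q)) = smult c q2"
      using main unfolding ce by (simp add: mult.commute)
    then have "smult [:e ^ degree c:] (smult c r + smult s q) = q2"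
      by (rule smult_cancel[OF c_nonzero])
    then show ?thesis by (simp add: s' smult_add_right mult.commute add.commute flip: s'u)
  qed
  have "c dvd v"
  proof -
    obtain m where m: "degree q = Suc m" using degree_q by (cases "degree q") auto
    have cq: "coeff q m = 0" using reduced m by (simp add: reduced_form_def centered_def)
    have "coeff q1 m = 0" unfolding coeff_q1 cq by simp
    moreover have "coeff q1 (Suc m) = [:a:]" using q1(2) unfolding m .
    ultimately have "coeff q2 m = [:u:] ^ m * (of_nat (Suc m) * v * [:a:])"
      using coeff_pcompose_linear_subtop[of q1 m v "[:u:]"] q1(1) unfolding q2_def m by simp
    moreover have "[:u:] ^ m * (of_nat (Suc m) * v * [:a:]) = v * [:u ^ m * of_nat (Suc m) * a:]"
      unfolding poly_const_pow of_nat_poly by (simp add: mult_ac)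
    moreover have "coeff q2 m = c * smult (e ^ degree c) (coeff r m)"
      unfolding q2_eq using cq by simp
    ultimately have "c * (smult (e ^ degree c) (coeff r m)) = v * [:u ^ m * of_nat (Suc m) * a:]"
      by simp
    then have "c dvd v * [:u ^ m * of_nat (Suc m) * a:]" by (metis dvd_triv_left)
    moreover have "u ^ m * of_nat (Suc m) * a \<noteq> 0" using u a by (simp del: of_nat_Suc)
    ultimately show ?thesis by (simp add: dvd_smult_iff)
  qed
  then obtain l where l: "v = c * l" by blast
  have Gq: "subst_xy e u q = smult [:u ^ degree q:] q"
  proof -
    define h where "h = subst_xy e u q - smult [:u ^ degree q:] q"
    have sub: "subst_xy e u q = q1 \<circ>\<^sub>p [:0, [:u:]:]" by (simp add: subst_xy_def q1_def b)
    have "[:c:] dvd [:0, [:u:]:] - [:v, [:u:]:]" by (simp add: l const_poly_dvd_iff coeff_pCons split: nat.split)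
    then have "[:c:] dvd q1 \<circ>\<^sub>p [:0, [:u:]:] - q2"
      unfolding q2_def by (rule dvd_pcompose_diff)
    then have "[:c:] dvd (q1 \<circ>\<^sub>p [:0, [:u:]:] - q2) + [:c:] * smult [:e ^ degree c:] r"
      by (intro dvd_add dvd_triv_left)
    then have "[:c:] dvd h" unfolding h_def sub q2_eq by simp
    moreover have "coeff h i = 0" for i
    proof (rule ccontr)
      assume nz: "coeff h i \<noteq> 0"
      have "c dvd coeff h i" using \<open>[:c:] dvd h\<close> by (simp add: const_poly_dvd_iff)
      then have le: "degree c \<le> degree (coeff h i)" using nz by (rule dvd_imp_degree_le)
      have ch: "coeff h i = smult (u ^ i) (coeff q i \<circ>\<^sub>p [:0, e:]) - smult (u ^ degree q) (coeff q i)"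
        by (simp add: h_def sub coeff_pcompose_linear coeff_q1 b poly_const_pow)
      then have "degree (coeff h i) \<le> degree (coeff q i)"
        unfolding ch by (intro degree_diff_le order.trans[OF degree_smult_le])
          (simp_all add: degree_pcompose)
      moreover have "coeff q i \<noteq> 0" using nz ch by auto
      then have "i \<le> degree q" by (rule le_degree)
      then have "degree (coeff q i) \<le> deg_x q" unfolding deg_x_def by (intro Max_ge) auto
      ultimately show False using le reduced by (simp add: reduced_form_def)
    qed
    ultimately have "h = 0" by (simp add: poly_eq_iff)
    then show ?thesis by (simp add: h_def)
  qed
  have \<sigma>x: "\<sigma> xfun = scalar e * xfun" using be b by (simp add: at_inf_pCons)
  have \<sigma>y: "\<sigma> yfun = scalar u * yfun + [:at_inf c:] * [:at_inf l:]"
    using vu l by (simp add: at_inf_const)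
  have "c \<circ>\<^sub>p [:0, e:] = smult (e ^ degree c) c" using ce b by (simp add: ce_def)
  then show thesis by (rule that[OF e u _ Gq \<sigma>x \<sigma>y])
qed

end

section \<open>Automorphisms commuting with a simple derivation\<close>

context danielewski
begin

text \<open>
In characteristic zero the difference of a nonconstant polynomial and its image under a nontrivial
shift has degree exactly one less than the polynomial.
\<close>

lemma shift_fixes_up_to_const:
  assumes "P \<circ>\<^sub>p [:w, 1:] - P = [:t:]" "w \<noteq> 0"
  shows "degree (P :: 'k poly poly) \<le> 1"
proof (rule ccontr)
  assume "\<not> degree P \<le> 1"
  then obtain m where m: "degree P = Suc (Suc m)"
    by (metis One_nat_def Suc_le_mono le0 not0_implies_Suc)
  have "coeff (P \<circ>\<^sub>p [:w, 1:] - P) (Suc m) = 0" unfolding assms(1) by simp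
  then have "of_nat (Suc (Suc m)) * w * lead_coeff P = 0"
    using coeff_pcompose_linear_subtop[of P "Suc m" w 1] m by simp
  moreover have "P \<noteq> 0" using m by auto
  ultimately show False using assms(2)
    unfolding mult_eq_0_iff leading_coeff_0_iff of_nat_eq_0_iff by simp
qed

text \<open>
Suppose \<open>l \<noteq> 0\<close>. The element \<open>\<delta> x\<close> is fixed by the shift \<open>\<sigma>\<close>, so it is some p in k[x]. The ideals
generated by p and, if \<open>p = 0\<close>, by x are stable, and simplicity leaves only a nonzero constant
for p. The difference of \<open>\<sigma> (\<delta> y)\<close> and \<open>\<delta> y\<close> is \<open>\<delta> (c l) = p (c l)'\<close>. It lies in k[x], so
\<open>\<delta> y = g0 + g1 y\<close>, and it equals \<open>g1 c l\<close>. Thus \<open>c l\<close> divides its own derivative, although it is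
not constant.
\<close>

theorem commuting_shift_trivial:
  assumes A: "endo \<sigma>" and \<delta>: "derivation \<delta>"
    and comm: "\<And>f. f \<in> B \<Longrightarrow> \<sigma> (\<delta> f) = \<delta> (\<sigma> f)"
    and x: "\<sigma> xfun = xfun" and y: "\<sigma> yfun = yfun + [:at_inf c:] * [:at_inf l:]"
    and simple: "\<And>p g. \<delta> [:at_inf p:] = [:at_inf p:] * g \<Longrightarrow> g \<in> B
        \<Longrightarrow> p = 0 \<or> (\<exists>h\<in>B. [:at_inf p:] * h = 1)"
  shows "l = 0"
proof (rule ccontr)
  assume "l \<noteq> 0"
  define w where "w = c * l"
  have w: "w \<noteq> 0" using \<open>l \<noteq> 0\<close> by (simp add: w_def)
  have degw: "degree w > 0" using \<open>l \<noteq> 0\<close> degree_c by (simp add: w_def degree_mult_eq)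
  note E = endo_rules[OF A] and D = derivation_rules[OF \<delta>]
  have x': "\<sigma> xfun = [:at_inf [:0, 1:]:]" unfolding x at_inf_X ..
  have fix_x: "\<sigma> [:at_inf p:] = [:at_inf p:]" for p
    using endo_at_inf[OF A x', of p] by (simp add: pcompose_idR)
  have y': "\<sigma> yfun = kxy [:w, 1:]" using y by (simp add: w_def)
  have shift: "\<sigma> (kxy P) = kxy (P \<circ>\<^sub>p [:w, 1:])" for P
    using endo_kxy[OF A x' y', of P] by (simp add: pcompose_idR)
  \<comment> \<open>elements of B that the shift changes only by an element t of k[x] are linear in y, and t is read off\<close>
  have diff: "f \<in> B \<Longrightarrow> \<sigma> f = f + [:at_inf t:] \<Longrightarrow> \<exists>g0 g1. f = kxy [:g0, g1:] \<and> g1 * w = t" for f t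
  proof -
    assume f: "f \<in> B" and ft: "\<sigma> f = f + [:at_inf t:]"
    obtain k P where kP: "[:at_inf (c ^ k):] * f = kxy P" using clear_denominators[OF f] by blast
    have "kxy (P \<circ>\<^sub>p [:w, 1:]) = [:at_inf (c ^ k):] * \<sigma> f"
      using E(3)[OF at_inf_in_B f, of "c ^ k"] unfolding kP fix_x shift .
    also have "\<dots> = kxy (P + [:c ^ k * t:])"
      unfolding ft distrib_left kP by simp
    finally have "P \<circ>\<^sub>p [:w, 1:] = P + [:c ^ k * t:]" by (simp only: kxy_eq_iff)
    then have "degree P \<le> 1" using shift_fixes_up_to_const[of P w] w by simp
    moreover have "degree P = degree f"
      using arg_cong[OF kP, of degree] by simp
    ultimately have "degree f \<le> 1" by simp
    then have "degree f < degree q" using degree_q by simp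
    then obtain R where R: "f = kxy R" using B_degree_less[OF f] by blast
    then have "degree R \<le> 1" using \<open>degree f \<le> 1\<close> by simp
    then obtain g0 g1 where g: "R = [:g0, g1:]" using degree_le_1_cases[of R] by blast
    have "kxy ([:g0, g1:] \<circ>\<^sub>p [:w, 1:]) = kxy ([:g0, g1:] + [:t:])"
      using ft unfolding R g shift by simp
    then have "[:g0, g1:] \<circ>\<^sub>p [:w, 1:] = [:g0, g1:] + [:t:]" by (simp only: kxy_eq_iff)
    then have "g1 * w = t" by (simp add: pcompose_pCons mult.commute)
    then show "\<exists>g0 g1. f = kxy [:g0, g1:] \<and> g1 * w = t" using R g by blast
  qed
  have "\<sigma> (\<delta> xfun) = \<delta> xfun + [:at_inf 0:]"
    using comm[OF xfun_in_B] x by simp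
  then obtain p g1 where "\<delta> xfun = kxy [:p, g1:]" "g1 * w = 0"
    using diff[OF D(1)[OF xfun_in_B]] by blast
  then have p: "\<delta> xfun = [:at_inf p:]" using w by simp
  have Dx: "\<delta> [:at_inf f:] = [:at_inf (pderiv f * p):]" for f
  proof (induction f)
    case 0
    then show ?case using D(4)[of 0] by simp
  next
    case (pCons a f)
    have "[:at_inf (pCons a f):] = scalar a + xfun * [:at_inf f:]"
      by (simp add: at_inf_pCons)
    then have "\<delta> [:at_inf (pCons a f):] = xfun * [:at_inf (pderiv f * p):] + [:at_inf p:] * [:at_inf f:]"
      by (simp only: D scalar_in_B xfun_in_B at_inf_in_B B_closed pCons.IH p add_0)
    also have "\<dots> = [:at_inf (pderiv (pCons a f) * p):]"
      by (simp add: pderiv_pCons at_inf_pCons algebra_simps)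
    finally show ?case .
  qed
  have unit: "degree f = 0" if fh: "[:at_inf f:] * h = 1" "h \<in> B" for f h
  proof -
    have "h \<noteq> 0" "f \<noteq> 0" using fh by auto
    then have "degree h = 0" using arg_cong[OF fh(1), of degree] by simp
    then obtain h' where "h = [:at_inf h':]" using B_degree_0[OF fh(2)] by blast
    then have "[:at_inf (f * h'):] = [:at_inf 1:]" using fh(1) by (simp add: pCons_one mult.commute)
    then have "f * h' = 1" unfolding pCons_eq_iff at_inf_eq_iff by simp
    then show ?thesis using \<open>f \<noteq> 0\<close> by (metis add_is_0 degree_1 degree_mult_eq mult_zero_right zero_neq_one)
  qed
  have "p \<noteq> 0"
  proof
    assume "p = 0"
    then have "\<delta> [:at_inf [:0, 1:]:] = [:at_inf [:0, 1:]:] * 0" using Dx by simp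
    then show False using simple[of "[:0, 1:]" 0] unit[of "[:0, 1:]"] scalar_in_B[of 0] by auto
  qed
  moreover have "\<delta> [:at_inf p:] = [:at_inf p:] * [:at_inf (pderiv p):]"
    unfolding Dx by (simp add: mult.commute)
  ultimately have "degree p = 0" using simple[OF _ at_inf_in_B] unit by blast
  then obtain p0 where p0: "p = [:p0:]" by (rule degree_eq_zeroE)
  have "\<sigma> (\<delta> yfun) = \<delta> yfun + [:at_inf (pderiv w * p):]"
  proof -
    have "\<sigma> yfun = yfun + [:at_inf w:]" using y by (simp add: w_def)
    then show ?thesis using comm[OF yfun_in_B] by (simp only: D yfun_in_B at_inf_in_B Dx)
  qed
  then obtain g1 where g1: "g1 * w = pderiv w * p" using diff[OF D(1)[OF yfun_in_B]] by blast
  have pd: "pderiv w \<noteq> 0" using degw by (simp add: pderiv_eq_0_iff)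
  have "w dvd pderiv w" using g1 \<open>p \<noteq> 0\<close> unfolding p0
    by (metis dvd_smult_cancel dvd_triv_right mult.commute mult_pCons_right mult_zero_right
        pCons_0_0 add_0_right)
  then have "degree w \<le> degree (pderiv w)" using pd by (rule dvd_imp_degree_le)
  then show False using degw by (simp add: degree_pderiv)
qed

end

section \<open>The quotient ring\<close>

lemma Kxyz_simps [simp]:
  "carrier (ring_of_type_algebra :: 'a::comm_ring_1 ring) = UNIV"
  "(f :: 'a) \<otimes>\<^bsub>ring_of_type_algebra\<^esub> g = f * g"
  "(f :: 'a) \<oplus>\<^bsub>ring_of_type_algebra\<^esub> g = f + g"
  "\<one>\<^bsub>(ring_of_type_algebra :: 'a ring)\<^esub> = 1"
  "\<zero>\<^bsub>(ring_of_type_algebra :: 'a ring)\<^esub> = 0"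
  by (simp_all add: ring_of_type_algebra_def)

context danielewski
begin

abbreviation A where "A \<equiv> dan_alg c q"

lemma ideal_dan_ideal: "ideal (dan_ideal c q) Kxyz"
  unfolding dan_ideal_def by (rule cring.cgenideal_ideal[OF cring_from_type_algebra]) simp

lemma cring_A: "cring A"
  unfolding dan_alg_def by (rule ideal.quotient_is_cring[OF ideal_dan_ideal cring_from_type_algebra])

lemma mem_dan_ideal: "f \<in> dan_ideal c q \<longleftrightarrow> dan_rel c q dvd f"
  by (auto simp: dan_ideal_def cgenideal_def dvd_def mult.commute)

lemma mem_cls: "g \<in> cls c q f \<longleftrightarrow> realize g = realize f"
proof -
  have "g \<in> cls c q f \<longleftrightarrow> g - f \<in> dan_ideal c q"
    unfolding cls_def a_r_coset_def' by (auto simp: algebra_simps intro!: bexI[of _ "g - f"])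
  also have "\<dots> \<longleftrightarrow> realize (g - f) = 0" by (simp only: mem_dan_ideal realize_eq_0_iff)
  finally show ?thesis by simp
qed

lemma carrier_A: "carrier A = range (cls c q)"
  by (auto simp: dan_alg_def FactRing_def A_RCOSETS_def' cls_def)

lemma cls_hom:
  "cls c q f \<otimes>\<^bsub>A\<^esub> cls c q g = cls c q (f * g)"
  "cls c q f \<oplus>\<^bsub>A\<^esub> cls c q g = cls c q (f + g)"
  "\<one>\<^bsub>A\<^esub> = cls c q 1" "\<zero>\<^bsub>A\<^esub> = cls c q 0"
proof -
  note H = ideal.rcos_ring_hom[OF ideal_dan_ideal, folded dan_alg_def]
  show "cls c q f \<otimes>\<^bsub>A\<^esub> cls c q g = cls c q (f * g)"
    "cls c q f \<oplus>\<^bsub>A\<^esub> cls c q g = cls c q (f + g)" "\<one>\<^bsub>A\<^esub> = cls c q 1"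
    using ring_hom_mult[OF H, of f g] ring_hom_add[OF H, of f g] ring_hom_one[OF H]
    by (simp_all add: cls_def)
  have "cls c q 0 = dan_ideal c q"
    unfolding set_eq_iff by (simp only: mem_cls mem_dan_ideal realize_hom realize_eq_0_iff) simp
  then show "\<zero>\<^bsub>A\<^esub> = cls c q 0" by (simp add: dan_alg_def FactRing_def)
qed

text \<open>
The isomorphism from the quotient ring to \<open>B\<close> and its inverse. A coset is the set of all
polynomials with a given realization, so no choice is involved in the inverse.
\<close>

definition fun_of :: "'k poly poly poly set \<Rightarrow> 'k fls poly" where
  "fun_of S = realize (SOME f. f \<in> S)"

definition coset_of :: "'k fls poly \<Rightarrow> 'k poly poly poly set" where
  "coset_of f = {P. realize P = f}"

lemma fun_of_cls [simp]: "fun_of (cls c q f) = realize f"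
proof -
  have "(SOME g. g \<in> cls c q f) \<in> cls c q f" by (rule someI[of _ f]) (simp add: mem_cls)
  then show ?thesis by (simp add: fun_of_def mem_cls)
qed

lemma coset_of_realize [simp]: "coset_of (realize P) = cls c q P"
  by (auto simp: coset_of_def mem_cls)

lemma fun_of_in_B: "S \<in> carrier A \<Longrightarrow> fun_of S \<in> B"
  by (auto simp: carrier_A B_def)

lemma coset_of_in_A: "f \<in> B \<Longrightarrow> coset_of f \<in> carrier A"
  by (auto simp: carrier_A B_def)

lemma coset_of_fun_of: "S \<in> carrier A \<Longrightarrow> coset_of (fun_of S) = S"
  by (auto simp: carrier_A)

lemma fun_of_coset_of: "f \<in> B \<Longrightarrow> fun_of (coset_of f) = f"
  by (auto simp: B_def)

lemma fun_of_eqI: "S \<in> carrier A \<Longrightarrow> T \<in> carrier A \<Longrightarrow> fun_of S = fun_of T \<Longrightarrow> S = T"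
  by (metis coset_of_fun_of)

lemma fun_of_hom:
  "S \<in> carrier A \<Longrightarrow> T \<in> carrier A \<Longrightarrow> fun_of (S \<otimes>\<^bsub>A\<^esub> T) = fun_of S * fun_of T"
  "S \<in> carrier A \<Longrightarrow> T \<in> carrier A \<Longrightarrow> fun_of (S \<oplus>\<^bsub>A\<^esub> T) = fun_of S + fun_of T"
  "fun_of \<one>\<^bsub>A\<^esub> = 1" "fun_of \<zero>\<^bsub>A\<^esub> = 0"
  by (auto simp: carrier_A cls_hom)

lemma coset_of_hom:
  "f \<in> B \<Longrightarrow> g \<in> B \<Longrightarrow> coset_of (f * g) = coset_of f \<otimes>\<^bsub>A\<^esub> coset_of g"
  "f \<in> B \<Longrightarrow> g \<in> B \<Longrightarrow> coset_of (f + g) = coset_of f \<oplus>\<^bsub>A\<^esub> coset_of g"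
proof -
  show "f \<in> B \<Longrightarrow> g \<in> B \<Longrightarrow> coset_of (f * g) = coset_of f \<otimes>\<^bsub>A\<^esub> coset_of g"
    by (auto simp: B_def cls_hom simp flip: realize_hom)
  show "f \<in> B \<Longrightarrow> g \<in> B \<Longrightarrow> coset_of (f + g) = coset_of f \<oplus>\<^bsub>A\<^esub> coset_of g"
    by (auto simp: B_def cls_hom simp flip: realize_hom)
qed

lemma generators_in_A [simp]:
  "scal c q a \<in> carrier A" "cls_x c q p \<in> carrier A" "xbar c q \<in> carrier A" "ybar c q \<in> carrier A"
  by (simp_all add: carrier_A scal_def cls_x_def xbar_def ybar_def)

lemma fun_of_generators [simp]:
  "fun_of (scal c q a) = scalar a" "fun_of (cls_x c q p) = [:at_inf p:]"
  "fun_of (xbar c q) = xfun" "fun_of (ybar c q) = yfun"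
  by (simp_all add: scal_def cls_x_def xbar_def ybar_def at_inf_const at_inf_X)

lemma coset_of_generators [simp]:
  "coset_of (scalar a) = scal c q a" "coset_of [:at_inf p:] = cls_x c q p"
  "coset_of xfun = xbar c q" "coset_of yfun = ybar c q"
  using coset_of_fun_of[OF generators_in_A(1)] coset_of_fun_of[OF generators_in_A(2)]
    coset_of_fun_of[OF generators_in_A(3)] coset_of_fun_of[OF generators_in_A(4)]
  by simp_all

text \<open>
Self-maps of the quotient ring, seen as self-maps of \<open>B\<close>.
\<close>

definition transport :: "('k poly poly poly set \<Rightarrow> 'k poly poly poly set) \<Rightarrow> 'k fls poly \<Rightarrow> 'k fls poly" where
  "transport s f = fun_of (s (coset_of f))"

lemma transport_fun_of: "S \<in> carrier A \<Longrightarrow> transport s (fun_of S) = fun_of (s S)"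
  by (simp add: transport_def coset_of_fun_of)

lemma transport_comp:
  "f \<in> B \<Longrightarrow> t \<in> carrier A \<rightarrow> carrier A \<Longrightarrow> transport s (transport t f) = fun_of (s (t (coset_of f)))"
  by (simp add: transport_def coset_of_fun_of coset_of_in_A funcset_mem[of t "carrier A" "carrier A"])

lemma carrier_dan_Aut:
  "s \<in> carrier (dan_Aut c q) \<longleftrightarrow>
     s \<in> Bij (carrier A) \<and> s \<in> ring_hom A A \<and> (\<forall>a. s (scal c q a) = scal c q a)"
  by (simp add: dan_Aut_def Let_def)

lemma endo_transport:
  assumes "s \<in> ring_hom A A" "\<And>a. s (scal c q a) = scal c q a"
  shows "endo (transport s)"
proof -
  have "s S \<in> carrier A" if "S \<in> carrier A" for S
    using ring_hom_closed[OF assms(1) that] .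
  then show ?thesis
    unfolding endo_def transport_def
    by (auto simp: fun_of_in_B coset_of_in_A coset_of_hom fun_of_hom assms(2)
        ring_hom_mult[OF assms(1)] ring_hom_add[OF assms(1)])
qed

lemma derivation_transport:
  assumes "D \<in> dan_Der c q"
  shows "derivation (transport D)"
proof -
  have D: "D \<in> carrier A \<rightarrow> carrier A"
    "\<And>f g. f \<in> carrier A \<Longrightarrow> g \<in> carrier A \<Longrightarrow> D (f \<oplus>\<^bsub>A\<^esub> g) = D f \<oplus>\<^bsub>A\<^esub> D g"
    "\<And>a f. f \<in> carrier A \<Longrightarrow> D (scal c q a \<otimes>\<^bsub>A\<^esub> f) = scal c q a \<otimes>\<^bsub>A\<^esub> D f"
    "\<And>f g. f \<in> carrier A \<Longrightarrow> g \<in> carrier A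
        \<Longrightarrow> D (f \<otimes>\<^bsub>A\<^esub> g) = (f \<otimes>\<^bsub>A\<^esub> D g) \<oplus>\<^bsub>A\<^esub> (D f \<otimes>\<^bsub>A\<^esub> g)"
    using assms by (auto simp: dan_Der_def Let_def)
  interpret cring A by (rule cring_A)
  have D': "D f \<in> carrier A" if "f \<in> carrier A" for f using D(1) that by blast
  have "fun_of (D (scal c q a)) = 0" for a
  proof -
    have sc1: "scal c q a \<otimes>\<^bsub>A\<^esub> \<one>\<^bsub>A\<^esub> = scal c q a" by simp
    have "fun_of (D \<one>\<^bsub>A\<^esub>) = fun_of (D \<one>\<^bsub>A\<^esub>) + fun_of (D \<one>\<^bsub>A\<^esub>)"
      using arg_cong[OF D(4)[OF one_closed one_closed], of fun_of] D'[OF one_closed]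
      by (simp add: fun_of_hom)
    then have "fun_of (D \<one>\<^bsub>A\<^esub>) = 0" by simp
    then show ?thesis
      using arg_cong[OF D(3)[OF one_closed, of a], of fun_of] D'[OF one_closed]
      unfolding sc1 by (simp add: fun_of_hom)
  qed
  then show ?thesis
    unfolding derivation_def transport_def
    by (auto simp: fun_of_in_B D' coset_of_in_A coset_of_hom D fun_of_hom fun_of_coset_of)
qed

lemma bij_A:
  assumes "s \<in> Bij (carrier A)" "S \<in> carrier A"
  shows "s S \<in> carrier A" "inv_into (carrier A) s S \<in> carrier A"
    "s (inv_into (carrier A) s S) = S" "inv_into (carrier A) s (s S) = S"
  using assms Bij_imp_funcset[OF assms(1)] Bij_inv_into_mem[OF assms]
  by (auto simp: Bij_def bij_betw_def f_inv_into_f)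

lemma dan_Aut_inverse:
  assumes "s \<in> carrier (dan_Aut c q)"
  shows "restrict (inv_into (carrier A) s) (carrier A) \<in> carrier (dan_Aut c q)"
proof -
  interpret cring A by (rule cring_A)
  have s: "s \<in> Bij (carrier A)" "s \<in> ring_hom A A" "\<And>a. s (scal c q a) = scal c q a"
    using assms by (auto simp: carrier_dan_Aut)
  let ?t = "inv_into (carrier A) s"
  have inj: "S = T" if "S \<in> carrier A" "T \<in> carrier A" "s S = s T" for S T
    using that bij_A(4)[OF s(1)] by metis
  have t: "?t (S \<otimes>\<^bsub>A\<^esub> T) = ?t S \<otimes>\<^bsub>A\<^esub> ?t T" "?t (S \<oplus>\<^bsub>A\<^esub> T) = ?t S \<oplus>\<^bsub>A\<^esub> ?t T"
    if "S \<in> carrier A" "T \<in> carrier A" for S T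
    by (rule inj; simp add: that bij_A[OF s(1)] ring_hom_mult[OF s(2)] ring_hom_add[OF s(2)])+
  have t1: "?t \<one>\<^bsub>A\<^esub> = \<one>\<^bsub>A\<^esub>"
    by (rule inj) (simp_all add: bij_A[OF s(1)] ring_hom_one[OF s(2)])
  have "restrict ?t (carrier A) \<in> ring_hom A A"
    by (rule ring_hom_memI) (simp_all add: bij_A[OF s(1)] t t1)
  moreover have "?t (scal c q a) = scal c q a" for a
    using bij_A(4)[OF s(1), of "scal c q a"] s(3) by simp
  ultimately show ?thesis by (simp add: carrier_dan_Aut restrict_inv_into_Bij[OF s(1)])
qed

lemma mutually_inverse_transport:
  assumes "s \<in> carrier (dan_Aut c q)"
  shows "mutually_inverse (transport s) (transport (restrict (inv_into (carrier A) s) (carrier A)))"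
proof -
  have s: "s \<in> Bij (carrier A)" "s \<in> ring_hom A A" "\<And>a. s (scal c q a) = scal c q a"
    using assms by (auto simp: carrier_dan_Aut)
  have t: "restrict (inv_into (carrier A) s) (carrier A) \<in> ring_hom A A"
    "\<And>a. restrict (inv_into (carrier A) s) (carrier A) (scal c q a) = scal c q a"
    using dan_Aut_inverse[OF assms] by (auto simp: carrier_dan_Aut)
  have "endo (transport s)" "endo (transport (restrict (inv_into (carrier A) s) (carrier A)))"
    by (intro endo_transport s t)+
  moreover have "restrict (inv_into (carrier A) s) (carrier A) \<in> carrier A \<rightarrow> carrier A"
    "s \<in> carrier A \<rightarrow> carrier A" using bij_A[OF s(1)] by auto
  ultimately show ?thesis
    unfolding mutually_inverse_def
    by (simp add: transport_comp coset_of_in_A bij_A[OF s(1)] fun_of_coset_of)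
qed

section \<open>The two groups and the homomorphism between them\<close>

text \<open>
Membership in the group in terms of coefficients: the weights of all monomials occurring in c,
respectively q, agree. In this form closure under products and inverses is immediate.
\<close>

lemma mem_dan_G:
  "(e, u) \<in> carrier (dan_G c q) \<longleftrightarrow> e \<noteq> 0 \<and> u \<noteq> 0 \<and>
     (\<forall>i. coeff c i \<noteq> 0 \<longrightarrow> e ^ i = e ^ degree c) \<and>
     (\<forall>i j. coeff (coeff q i) j \<noteq> 0 \<longrightarrow> e ^ j * u ^ i = u ^ degree q)"
proof -
  have "c \<circ>\<^sub>p [:0, e:] = smult (e ^ degree c) c \<longleftrightarrow> (\<forall>i. coeff c i \<noteq> 0 \<longrightarrow> e ^ i = e ^ degree c)"
    by (auto simp: poly_eq_iff coeff_pcompose_linear)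
  moreover have "coeff (coeff (subst_xy e u q) i) j = e ^ j * u ^ i * coeff (coeff q i) j" for i j
    by (simp add: subst_xy_def coeff_pcompose_linear coeff_map_poly poly_const_pow mult_ac)
  then have "subst_xy e u q = smult [:u ^ degree q:] q
      \<longleftrightarrow> (\<forall>i j. coeff (coeff q i) j \<noteq> 0 \<longrightarrow> e ^ j * u ^ i = u ^ degree q)"
    by (auto simp: poly_eq_iff)
  ultimately show ?thesis by (simp add: dan_G_def)
qed

lemma mult_dan_G: "(e, u) \<otimes>\<^bsub>dan_G c q\<^esub> (e', u') = (e * e', u * u')"
  and one_dan_G: "\<one>\<^bsub>dan_G c q\<^esub> = (1, 1)"
  by (simp_all add: dan_G_def)

lemma group_dan_G: "group (dan_G c q)"
proof (rule groupI)
  show "g \<otimes>\<^bsub>dan_G c q\<^esub> h \<in> carrier (dan_G c q)"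
    if g: "g \<in> carrier (dan_G c q)" and h: "h \<in> carrier (dan_G c q)" for g h
  proof -
    obtain e u e' u' where gh: "g = (e, u)" "h = (e', u')" by (cases g; cases h)
    note G = g[unfolded gh mem_dan_G] h[unfolded gh mem_dan_G]
    have "(e * e') ^ i = (e * e') ^ degree c" if "coeff c i \<noteq> 0" for i
    proof -
      have "e ^ i = e ^ degree c" "e' ^ i = e' ^ degree c" using G that by blast+
      then show ?thesis by (simp only: power_mult_distrib)
    qed
    moreover have "(e * e') ^ j * (u * u') ^ i = (u * u') ^ degree q"
      if "coeff (coeff q i) j \<noteq> 0" for i j
    proof -
      have "(e * e') ^ j * (u * u') ^ i = (e ^ j * u ^ i) * (e' ^ j * u' ^ i)"
        by (simp add: power_mult_distrib mult_ac)
      moreover have "e ^ j * u ^ i = u ^ degree q" "e' ^ j * u' ^ i = u' ^ degree q"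
        using G that by blast+
      ultimately show ?thesis by (simp only: power_mult_distrib)
    qed
    moreover have "e \<noteq> 0 \<and> u \<noteq> 0 \<and> e' \<noteq> 0 \<and> u' \<noteq> 0" using G by blast
    then have "e * e' \<noteq> 0" "u * u' \<noteq> 0" by simp_all
    ultimately show ?thesis unfolding gh mult_dan_G mem_dan_G by blast
  qed
  show "\<exists>h\<in>carrier (dan_G c q). h \<otimes>\<^bsub>dan_G c q\<^esub> g = \<one>\<^bsub>dan_G c q\<^esub>"
    if g: "g \<in> carrier (dan_G c q)" for g
  proof -
    obtain e u where g': "g = (e, u)" by (cases g)
    note G = g[unfolded g' mem_dan_G]
    have "inverse e ^ i = inverse e ^ degree c" if "coeff c i \<noteq> 0" for i
    proof -
      have "e ^ i = e ^ degree c" using G that by blast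
      then show ?thesis by (simp only: power_inverse)
    qed
    moreover have "inverse e ^ j * inverse u ^ i = inverse u ^ degree q"
      if "coeff (coeff q i) j \<noteq> 0" for i j
    proof -
      have "inverse e ^ j * inverse u ^ i = inverse (e ^ j * u ^ i)"
        by (simp add: power_inverse)
      moreover have "e ^ j * u ^ i = u ^ degree q" using G that by blast
      ultimately show ?thesis by (simp only: power_inverse)
    qed
    moreover have nz: "e \<noteq> 0 \<and> u \<noteq> 0" using G by blast
    then have "inverse e \<noteq> 0" "inverse u \<noteq> 0" by simp_all
    ultimately have "(inverse e, inverse u) \<in> carrier (dan_G c q)"
      unfolding mem_dan_G by blast
    moreover have "(inverse e, inverse u) \<otimes>\<^bsub>dan_G c q\<^esub> g = \<one>\<^bsub>dan_G c q\<^esub>"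
      using nz by (simp add: g' mult_dan_G one_dan_G)
    ultimately show ?thesis by blast
  qed
qed (auto simp: mult_dan_G one_dan_G mem_dan_G mult_ac)

text \<open>
The property that characterizes the value of \<open>\<psi>\<close>, for maps on \<open>B\<close>.
\<close>

definition affine :: "'k \<times> 'k \<Rightarrow> ('k fls poly \<Rightarrow> 'k fls poly) \<Rightarrow> bool" where
  "affine g \<sigma> \<longleftrightarrow> g \<in> carrier (dan_G c q) \<and> \<sigma> xfun = scalar (fst g) * xfun
     \<and> (\<exists>l. \<sigma> yfun = scalar (snd g) * yfun + [:at_inf c:] * [:at_inf l:])"

lemma affine_unique:
  assumes "affine g \<sigma>" "affine h \<sigma>"
  shows "g = h"
proof -
  have inject: "a = b" if "fls_const a = fls_const b" for a b :: 'k
    using arg_cong[OF that, of "\<lambda>f. f $$ 0"] by simp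
  have "fls_const (fst g) = fls_const (fst h)" "fls_const (snd g) = fls_const (snd h)"
    using assms by (auto simp: affine_def)
  then show ?thesis by (auto simp: prod_eq_iff dest: inject)
qed

text \<open>
The equation \<open>c(e x) = e\<^sup>n c\<close> keeps the translation part of the composite divisible by c.
\<close>

lemma affine_comp:
  assumes \<sigma>: "affine g \<sigma>" "endo \<sigma>" and \<tau>: "affine h \<tau>"
  shows "affine (g \<otimes>\<^bsub>dan_G c q\<^esub> h) (\<lambda>f. \<sigma> (\<tau> f))"
proof -
  obtain e u e' u' where gh: "g = (e, u)" "h = (e', u')" by (cases g; cases h)
  note E = endo_rules[OF \<sigma>(2)]
  have \<sigma>x: "\<sigma> xfun = scalar e * xfun" and \<tau>x: "\<tau> xfun = scalar e' * xfun"
    using \<sigma>(1) \<tau> by (auto simp: affine_def gh)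
  obtain l where l: "\<sigma> yfun = scalar u * yfun + [:at_inf c:] * [:at_inf l:]"
    using \<sigma>(1) unfolding affine_def gh by auto
  obtain l' where l': "\<tau> yfun = scalar u' * yfun + [:at_inf c:] * [:at_inf l':]"
    using \<tau> unfolding affine_def gh by auto
  have h: "\<sigma> xfun = [:at_inf [:0, e:]:]" using \<sigma>x by (simp add: at_inf_pCons mult.commute)
  have ce: "c \<circ>\<^sub>p [:0, e:] = smult (e ^ degree c) c"
    using \<sigma>(1) by (simp add: affine_def gh dan_G_def)
  have const: "at_inf (smult a p) = fls_const a * at_inf p" for a p
    using at_inf_hom(3)[of "[:a:]" p] by (simp add: at_inf_const)
  have "\<sigma> (\<tau> yfun) = scalar u' * \<sigma> yfun + [:at_inf (c \<circ>\<^sub>p [:0, e:]):] * [:at_inf (l' \<circ>\<^sub>p [:0, e:]):]"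
    unfolding l'
    by (simp only: E scalar_in_B yfun_in_B at_inf_in_B B_closed endo_at_inf[OF \<sigma>(2) h])
  also have "\<dots> = scalar (u * u') * yfun
      + [:at_inf c:] * [:at_inf (smult u' l + smult (e ^ degree c) (l' \<circ>\<^sub>p [:0, e:])):]"
    unfolding l ce const at_inf_hom by (simp add: algebra_simps)
  finally have "\<exists>l. \<sigma> (\<tau> yfun) = scalar (u * u') * yfun + [:at_inf c:] * [:at_inf l:]" by blast
  moreover have "\<sigma> (\<tau> xfun) = scalar (e * e') * xfun"
    unfolding \<tau>x by (simp only: E scalar_in_B xfun_in_B \<sigma>x) (simp add: mult_ac)
  moreover have "g \<otimes>\<^bsub>dan_G c q\<^esub> h \<in> carrier (dan_G c q)"
    using \<sigma>(1) \<tau> by (intro monoid.m_closed group.is_monoid[OF group_dan_G]) (auto simp: affine_def)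
  ultimately show ?thesis by (simp add: affine_def gh mult_dan_G)
qed

lemma affine_transport:
  assumes s: "s \<in> carrier A \<rightarrow> carrier A"
  shows "affine (e, u) (transport s) \<longleftrightarrow> (e, u) \<in> carrier (dan_G c q) \<and>
       s (xbar c q) = scal c q e \<otimes>\<^bsub>A\<^esub> xbar c q \<and>
       (\<exists>l. s (ybar c q) =
          (scal c q u \<otimes>\<^bsub>A\<^esub> ybar c q) \<oplus>\<^bsub>A\<^esub> (cls_x c q c \<otimes>\<^bsub>A\<^esub> cls_x c q l))"
proof -
  interpret cring A by (rule cring_A)
  have sxy: "s (xbar c q) \<in> carrier A" "s (ybar c q) \<in> carrier A" using s by auto
  have eq: "S = T \<longleftrightarrow> fun_of S = fun_of T" if "S \<in> carrier A" "T \<in> carrier A" for S T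
    using fun_of_eqI that by blast
  have "transport s xfun = fun_of (s (xbar c q))" "transport s yfun = fun_of (s (ybar c q))"
    by (simp_all add: transport_def)
  then show ?thesis
    unfolding affine_def using sxy by (simp add: eq fun_of_hom del: pCons_eq_iff)
qed

lemma dan_psi_eq:
  assumes "s \<in> carrier A \<rightarrow> carrier A" "affine g (transport s)"
  shows "dan_psi c q s = g"
proof -
  have "dan_psi c q s = (THE (e, u). affine (e, u) (transport s))"
    unfolding dan_psi_def affine_transport[OF assms(1)] Let_def ..
  also have "\<dots> = (THE g. affine g (transport s))" by (simp add: case_prod_unfold)
  also have "\<dots> = g" using assms(2) affine_unique by (intro the_equality)
  finally show ?thesis .
qed

lemma dan_AutD_eq:
  "dan_AutD c q D = (BijGroup (carrier A))\<lparr>carrier := carrier (dan_AutD c q D)\<rparr>"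
  by (simp add: dan_AutD_def dan_Aut_def Let_def)

lemma carrier_dan_AutD:
  "s \<in> carrier (dan_AutD c q D) \<longleftrightarrow> s \<in> carrier (dan_Aut c q) \<and> (\<forall>f\<in>carrier A. s (D f) = D (s f))"
  by (simp add: dan_AutD_def)

lemma dan_AutD_Bij: "s \<in> carrier (dan_AutD c q D) \<Longrightarrow> s \<in> Bij (carrier A)"
  by (simp add: carrier_dan_AutD carrier_dan_Aut)

lemma mult_dan_AutD:
  assumes "s \<in> carrier (dan_AutD c q D)" "t \<in> carrier (dan_AutD c q D)"
  shows "s \<otimes>\<^bsub>dan_AutD c q D\<^esub> t = compose (carrier A) s t"
  using dan_AutD_Bij[OF assms(1)] dan_AutD_Bij[OF assms(2)]
  by (subst dan_AutD_eq) (simp add: BijGroup_def)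

lemma one_dan_AutD: "\<one>\<^bsub>dan_AutD c q D\<^esub> = (\<lambda>S\<in>carrier A. S)"
  by (subst dan_AutD_eq) (simp add: BijGroup_def)

lemma group_dan_AutD:
  assumes D: "D \<in> carrier A \<rightarrow> carrier A"
  shows "group (dan_AutD c q D)"
proof -
  interpret cring A by (rule cring_A)
  have "subgroup (carrier (dan_AutD c q D)) (BijGroup (carrier A))"
  proof (rule group.subgroupI[OF group_BijGroup])
    show "carrier (dan_AutD c q D) \<subseteq> carrier (BijGroup (carrier A))"
      using dan_AutD_Bij by (auto simp: BijGroup_def)
    have "(\<lambda>S\<in>carrier A. S) \<in> ring_hom A A" by (rule ring_hom_memI) auto
    then have "(\<lambda>S\<in>carrier A. S) \<in> carrier (dan_AutD c q D)"
      using D by (auto simp: carrier_dan_AutD carrier_dan_Aut id_Bij)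
    then show "carrier (dan_AutD c q D) \<noteq> {}" by blast
  next
    fix s assume s: "s \<in> carrier (dan_AutD c q D)"
    note b = bij_A[OF dan_AutD_Bij[OF s]]
    have sA: "s \<in> carrier (dan_Aut c q)" and comm: "\<And>f. f \<in> carrier A \<Longrightarrow> s (D f) = D (s f)"
      using s by (auto simp: carrier_dan_AutD)
    let ?t = "inv_into (carrier A) s"
    have "?t (D f) = D (?t f)" if f: "f \<in> carrier A" for f
    proof -
      have "s (D (?t f)) = D f" using comm[of "?t f"] b f by simp
      then show ?thesis using b(4)[of "D (?t f)"] b(2)[OF f] D by auto
    qed
    then have "restrict ?t (carrier A) \<in> carrier (dan_AutD c q D)"
      using dan_Aut_inverse[OF sA] D b by (auto simp: carrier_dan_AutD)
    then show "inv\<^bsub>BijGroup (carrier A)\<^esub> s \<in> carrier (dan_AutD c q D)"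
      using dan_AutD_Bij[OF s] by (simp add: inv_BijGroup)
  next
    fix s t assume st: "s \<in> carrier (dan_AutD c q D)" "t \<in> carrier (dan_AutD c q D)"
    note b = bij_A(1)[OF dan_AutD_Bij[OF st(1)]] bij_A(1)[OF dan_AutD_Bij[OF st(2)]]
    have hom: "s \<in> ring_hom A A" "t \<in> ring_hom A A"
      and sc: "\<And>a. s (scal c q a) = scal c q a" "\<And>a. t (scal c q a) = scal c q a"
      and comm: "\<And>f. f \<in> carrier A \<Longrightarrow> s (D f) = D (s f)" "\<And>f. f \<in> carrier A \<Longrightarrow> t (D f) = D (t f)"
      using st by (auto simp: carrier_dan_AutD carrier_dan_Aut)
    have "compose (carrier A) s t \<in> ring_hom A A"
      by (rule ring_hom_memI)
        (auto simp: compose_def b ring_hom_one[OF hom(1)] ring_hom_one[OF hom(2)] ring_hom_mult[OF hom(1)]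
          ring_hom_mult[OF hom(2)] ring_hom_add[OF hom(1)] ring_hom_add[OF hom(2)])
    moreover have "compose (carrier A) s t (D f) = D (compose (carrier A) s t f)" if "f \<in> carrier A" for f
      using that funcset_mem[OF D that] b by (simp add: compose_def comm)
    ultimately have "compose (carrier A) s t \<in> carrier (dan_AutD c q D)"
      using compose_Bij[OF dan_AutD_Bij[OF st(1)] dan_AutD_Bij[OF st(2)]]
      by (auto simp: carrier_dan_AutD carrier_dan_Aut compose_def sc)
    then show "s \<otimes>\<^bsub>BijGroup (carrier A)\<^esub> t \<in> carrier (dan_AutD c q D)"
      using dan_AutD_Bij[OF st(1)] dan_AutD_Bij[OF st(2)] by (simp add: BijGroup_def)
  qed
  then have "group ((BijGroup (carrier A))\<lparr>carrier := carrier (dan_AutD c q D)\<rparr>)"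
    by (rule subgroup.subgroup_is_group[OF _ group_BijGroup])
  then show ?thesis by (simp add: dan_AutD_eq[symmetric])
qed

text \<open>
The form in which simplicity is used: if p divides \<open>D p\<close>, the principal ideal generated by p is
stable under D.
\<close>

lemma simple_transport:
  assumes D: "D \<in> dan_Der c q" and simple: "simple_derivation A D"
    and stable: "transport D [:at_inf p:] = [:at_inf p:] * g" "g \<in> B"
  shows "p = 0 \<or> (\<exists>h\<in>B. [:at_inf p:] * h = 1)"
proof -
  interpret cring A by (rule cring_A)
  have DA: "D f \<in> carrier A" if "f \<in> carrier A" for f
    using D that by (auto simp: dan_Der_def Let_def)
  have Leibniz: "D (f \<otimes>\<^bsub>A\<^esub> h) = (f \<otimes>\<^bsub>A\<^esub> D h) \<oplus>\<^bsub>A\<^esub> (D f \<otimes>\<^bsub>A\<^esub> h)"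
    if "f \<in> carrier A" "h \<in> carrier A" for f h
    using D that by (auto simp: dan_Der_def Let_def)
  define a where "a = cls_x c q p"
  define I where "I = PIdl\<^bsub>A\<^esub> a"
  have a: "a \<in> carrier A" by (simp add: a_def)
  have Da: "D a = coset_of g \<otimes>\<^bsub>A\<^esub> a"
    using stable DA[OF a] coset_of_in_A[OF stable(2)]
    by (intro fun_of_eqI) (simp_all add: fun_of_hom a_def transport_def fun_of_coset_of)
  have "D ` I \<subseteq> I"
  proof (rule image_subsetI)
    fix S assume "S \<in> I"
    then obtain f where f: "f \<in> carrier A" "S = f \<otimes>\<^bsub>A\<^esub> a" by (auto simp: I_def cgenideal_def)
    have "D S = (f \<otimes>\<^bsub>A\<^esub> coset_of g \<oplus>\<^bsub>A\<^esub> D f) \<otimes>\<^bsub>A\<^esub> a"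
      using f a DA coset_of_in_A[OF stable(2)] by (simp add: Leibniz Da l_distr m_assoc)
    moreover have "f \<otimes>\<^bsub>A\<^esub> coset_of g \<oplus>\<^bsub>A\<^esub> D f \<in> carrier A"
      using f DA coset_of_in_A[OF stable(2)] by simp
    ultimately show "D S \<in> I" unfolding I_def cgenideal_def by blast
  qed
  moreover have "ideal I A" unfolding I_def by (rule cgenideal_ideal[OF a])
  ultimately consider "I = {\<zero>\<^bsub>A\<^esub>}" | "I = carrier A"
    using simple unfolding simple_derivation_def by blast
  then show ?thesis
  proof cases
    case 1
    then have "a = \<zero>\<^bsub>A\<^esub>" using cgenideal_self[OF a] by (simp add: I_def)
    then have "fun_of a = 0" by (simp add: fun_of_hom)
    then show ?thesis by (simp add: a_def)
  next
    case 2
    then have "\<one>\<^bsub>A\<^esub> \<in> I" by simp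
    then obtain f where f: "f \<in> carrier A" "\<one>\<^bsub>A\<^esub> = f \<otimes>\<^bsub>A\<^esub> a" unfolding I_def cgenideal_def by blast
    then have "fun_of f * fun_of a = 1" using a by (simp add: fun_of_hom flip: fun_of_hom(1,3))
    then show ?thesis using fun_of_in_B[OF f(1)] by (auto simp: a_def mult.commute)
  qed
qed

end

context reduced_danielewski
begin

lemma affine_aut:
  assumes "s \<in> carrier (dan_Aut c q)"
  shows "\<exists>g. affine g (transport s)"
proof -
  obtain e u l where *: "e \<noteq> 0" "u \<noteq> 0"
    "c \<circ>\<^sub>p [:0, e:] = smult (e ^ degree c) c"
    "subst_xy e u q = smult [:u ^ degree q:] q"
    "transport s xfun = scalar e * xfun"
    "transport s yfun = scalar u * yfun + [:at_inf c:] * [:at_inf l:]"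
    by (rule aut_structure[OF mutually_inverse_transport[OF assms]])
  then have "(e, u) \<in> carrier (dan_G c q)" by (simp add: dan_G_def)
  then have "affine (e, u) (transport s)" unfolding affine_def using *(5,6) by auto
  then show ?thesis ..
qed

theorem dan_psi_mon:
  assumes D: "D \<in> dan_Der c q" and simple: "simple_derivation A D"
  shows "restrict (dan_psi c q) (carrier (dan_AutD c q D)) \<in> mon (dan_AutD c q D) (dan_G c q)"
proof -
  have DA: "D \<in> carrier A \<rightarrow> carrier A" using D by (auto simp: dan_Der_def Let_def)
  interpret AutD: group "dan_AutD c q D" by (rule group_dan_AutD[OF DA])
  let ?\<psi> = "restrict (dan_psi c q) (carrier (dan_AutD c q D))"
  have maps: "s \<in> carrier A \<rightarrow> carrier A" if "s \<in> carrier (dan_AutD c q D)" for s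
    using Bij_imp_funcset[OF dan_AutD_Bij[OF that]] .
  have psi: "affine (dan_psi c q s) (transport s)" if s: "s \<in> carrier (dan_AutD c q D)" for s
  proof -
    have "s \<in> carrier (dan_Aut c q)" using s by (simp add: carrier_dan_AutD)
    then obtain g where g: "affine g (transport s)" using affine_aut by blast
    then show ?thesis using dan_psi_eq[OF maps[OF s] g] by simp
  qed
  have endo: "endo (transport s)" if "s \<in> carrier (dan_AutD c q D)" for s
    using that by (intro endo_transport) (auto simp: carrier_dan_AutD carrier_dan_Aut)
  have "?\<psi> \<in> hom (dan_AutD c q D) (dan_G c q)"
  proof (rule homI)
    show "?\<psi> s \<in> carrier (dan_G c q)" if "s \<in> carrier (dan_AutD c q D)" for s
      using psi[OF that] that by (simp add: affine_def)
    fix s t assume st: "s \<in> carrier (dan_AutD c q D)" "t \<in> carrier (dan_AutD c q D)"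
    let ?st = "s \<otimes>\<^bsub>dan_AutD c q D\<^esub> t"
    have stc: "?st \<in> carrier (dan_AutD c q D)" using st by simp
    have eq: "transport ?st f = transport s (transport t f)" if "f \<in> B" for f
      using coset_of_in_A[OF that] transport_comp[OF that maps[OF st(2)]]
      by (simp add: transport_def mult_dan_AutD[OF st] compose_eq)
    have "affine (dan_psi c q s \<otimes>\<^bsub>dan_G c q\<^esub> dan_psi c q t) (\<lambda>f. transport s (transport t f))"
      by (rule affine_comp[OF psi[OF st(1)] endo[OF st(1)] psi[OF st(2)]])
    then have "affine (dan_psi c q s \<otimes>\<^bsub>dan_G c q\<^esub> dan_psi c q t) (transport ?st)"
      unfolding affine_def by (simp only: eq xfun_in_B yfun_in_B)
    then have "dan_psi c q ?st = dan_psi c q s \<otimes>\<^bsub>dan_G c q\<^esub> dan_psi c q t"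
      by (rule dan_psi_eq[OF maps[OF stc]])
    then show "?\<psi> ?st = ?\<psi> s \<otimes>\<^bsub>dan_G c q\<^esub> ?\<psi> t" using st stc by simp
  qed
  moreover have "s = \<one>\<^bsub>dan_AutD c q D\<^esub>"
    if s: "s \<in> carrier (dan_AutD c q D)" and one: "?\<psi> s = \<one>\<^bsub>dan_G c q\<^esub>" for s
  proof -
    have "affine (1, 1) (transport s)" using psi[OF s] one s by (simp add: one_dan_G)
    then obtain l where x: "transport s xfun = xfun"
      and l: "transport s yfun = yfun + [:at_inf c:] * [:at_inf l:]"
      by (auto simp: affine_def)
    have comm: "transport s (transport D f) = transport D (transport s f)" if "f \<in> B" for f
      using s coset_of_in_A[OF that]
      by (simp add: transport_comp[OF that DA] transport_comp[OF that maps[OF s]] carrier_dan_AutD)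
    have "l = 0"
      by (rule commuting_shift_trivial[OF endo[OF s] derivation_transport[OF D] comm x l
            simple_transport[OF D simple]])
    then have y: "transport s yfun = yfun" using l by simp
    have id: "endo (\<lambda>f. f)" by (simp add: endo_def)
    have "transport s f = f" if "f \<in> B" for f
      using endo_eqI[OF id endo[OF s] _ _ _ that] x y by simp
    then have "s S = S" if "S \<in> carrier A" for S
      using transport_fun_of[OF that, of s] fun_of_in_B[OF that] fun_of_eqI[of "s S" S] that maps[OF s]
      by auto
    then have "s = (\<lambda>S\<in>carrier A. S)"
      using Bij_imp_extensional[OF dan_AutD_Bij[OF s]] by (intro extensionalityI[of s "carrier A"]) auto
    then show ?thesis by (simp add: one_dan_AutD)
  qed
  ultimately show ?thesis
    unfolding mon_iff_hom_one[OF AutD.is_group group_dan_G] by simp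
qed

end

lemma mon_iso_image:
  assumes "group G" "group H" and h: "h \<in> mon G H"
  shows "subgroup (h ` carrier G) H \<and> G \<cong> H\<lparr>carrier := h ` carrier G\<rparr>"
proof
  interpret group_hom G H h
    using assms by (auto simp: group_hom_def group_hom_axioms_def mon_def)
  show "subgroup (h ` carrier G) H" by (rule img_is_subgroup)
  have "h \<in> iso G (H\<lparr>carrier := h ` carrier G\<rparr>)"
    using h by (auto simp: iso_def mon_def hom_def bij_betw_def)
  then show "G \<cong> H\<lparr>carrier := h ` carrier G\<rparr>" by (auto simp: is_iso_def)
qed

theorem corollary8:
  fixes c :: "'k::{alg_closed_field, field_char_0} poly"
    and q :: "'k poly poly"
    and D :: "'k poly poly poly set \<Rightarrow> 'k poly poly poly set"
  assumes "quasi_monic q"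
    and "reduced_form c q"
    and "degree c \<ge> 2"
    and "degree q \<ge> 2"
    and "D \<in> dan_Der c q"
    and "simple_derivation (dan_alg c q) D"
  shows "restrict (dan_psi c q) (carrier (dan_AutD c q D)) \<in> mon (dan_AutD c q D) (dan_G c q)
    \<and> (\<exists>H. subgroup H (dan_G c q) \<and> dan_AutD c q D \<cong> (dan_G c q)\<lparr>carrier := H\<rparr>)"
proof -
  interpret reduced_danielewski c q using assms(1-4) by unfold_locales
  have "D \<in> carrier (dan_alg c q) \<rightarrow> carrier (dan_alg c q)"
    using assms(5) by (auto simp: dan_Der_def Let_def)
  then have "group (dan_AutD c q D)" by (rule group_dan_AutD)
  moreover have mon: "restrict (dan_psi c q) (carrier (dan_AutD c q D)) \<in> mon (dan_AutD c q D) (dan_G c q)"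
    by (rule dan_psi_mon[OF assms(5,6)])
  ultimately show ?thesis using mon_iso_image[OF _ group_dan_G mon] by blast
qed

end
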